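(* (i) Let $n>1$ be an odd integer. Then there is no positive integer $m$ with $(f(m),d(m))=(n,2n)$, and there is no positive integer $m$ with $(f(m),d(m))=(n,4n)$. (ii) Let $L$ be a Linnik constant. There is a constant $C>0$ (depending only on $L$) such that for all odd primes $p,q$ with $p<q$, $p\mid q-1$ and $p^2\nmid q-1$, there exists a positive integer $m\le C\,p\,(pq)^{L+1}$ with $f(m)=q$ and $d(m)=pq$.
   Context: For a positive integer $m$, let $\varphi(m)$ be Euler's function and $\lambda(m)$ the Carmichael function (the exponent of the multiplicative group $(\mathbb{Z}/m\mathbb{Z})^*$). Let $\mathrm{rad}(m)$ be the product of the distinct primes dividing $m$. Let $\delta=2$ if $4\mid m$ and $\delta=1$ otherwise. Define $$ d(m)=\gcd\big(m,\ \delta\,\varphi(\mathrm{rad}(m))\big),\qquad f(m)=\gcd\big(m,\ \delta\,\lambda(m)\varphi(\mathrm{rad}(m))/\varphi(m)\big). $$ A Linnik constant is a positive number $L$ such that there is an absolute constant $c>0$ with the property that for all integers $1\le a<q$ with $\gcd(a,q)=1$, the smallest prime $p(a,q)$ in the progression $\{a+jq: j\ge 0\}$ satisfies $p(a,q)\le c\, q^L$ (such $L$ exist by Linnik's theorem; e.g. $L=5$ works). *)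

theory Defs
  imports "HOL-Number_Theory.Number_Theory"
begin

definition carmichael :: "nat \<Rightarrow> nat" where
  "carmichael m = (LEAST k. k > 0 \<and> (\<forall>a. coprime a m \<longrightarrow> [a ^ k = 1] (mod m)))"

definition rad :: "nat \<Rightarrow> nat" where
  "rad m = (\<Prod>p\<in>prime_factors m. p)"

definition delta :: "nat \<Rightarrow> nat" where
  "delta m = (if 4 dvd m then 2 else 1)"

definition dfun :: "nat \<Rightarrow> nat" where
  "dfun m = gcd m (delta m * totient (rad m))"

text \<open>The quotient delta*lambda(m)*phi(rad m)/phi(m) is always an integer, so nat div is exact.\<close>
definition ffun :: "nat \<Rightarrow> nat" where
  "ffun m = gcd m ((delta m * carmichael m * totient (rad m)) div totient m)"

definition linnik_constant :: "real \<Rightarrow> bool" where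
  "linnik_constant L \<longleftrightarrow> L > 0 \<and>
     (\<exists>c::real. c > 0 \<and> (\<forall>a q :: nat. 1 \<le> a \<and> a < q \<and> coprime a q \<longrightarrow>
        real (LEAST p. prime p \<and> (\<exists>j. p = a + j * q)) \<le> c * real q powr L))"

end

theory Submission
  imports "HOL-Analysis.Analysis" "HOL-Real_Asymp.Real_Asymp" Defs
begin

text \<open>
  (i) If \<open>8\<close> divides \<open>m\<close>, an odd prime \<open>r\<close> dividing \<open>d(m)\<close> divides \<open>t - 1\<close> for another odd prime
  \<open>t\<close> dividing \<open>m\<close>, so \<open>4\<close> divides \<open>\<phi>(rad m)\<close> and \<open>8\<close> divides \<open>d(m)\<close>. Otherwise the evenness of
  \<open>\<lambda>(m)\<close> forces \<open>f(m)\<close> to be even.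

  (ii) Take \<open>m = p\<^sup>2 q r\<close> with a prime \<open>r \<equiv> 1 (mod q)\<close>, \<open>r \<noteq> 1 (mod p)\<close>, minimal in its class modulo
  \<open>pq\<close>. The definition of a Linnik constant bounds \<open>r\<close> only if the class contains a prime at all
  (otherwise the \<open>LEAST\<close> is junk), so one such prime has to be produced. If every prime
  \<open>r \<equiv> 1 (mod q)\<close> were \<open>\<equiv> 1 (mod p)\<close>, then for a nontrivial character \<open>\<psi>\<close> modulo \<open>p\<close> the Euler products
  would make \<open>\<Prod>\<^sub>\<chi> |L(s, \<chi>)|\<close> and \<open>\<Prod>\<^sub>\<chi> |L(s, \<chi>\<psi>)|\<close> (over the characters \<open>\<chi>\<close> modulo \<open>q\<close>) agree up to
  bounded factors as \<open>s \<down> 1\<close>. The second product stays bounded; the first does not, because of the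
  pole of the principal factor and \<open>L(1, \<chi>) \<noteq> 0\<close> for the others. For nonreal \<open>\<chi>\<close> a zero would occur
  together with one of the conjugate, but the product over all \<open>\<chi>\<close> is bounded away from \<open>0\<close>; for
  quadratic \<open>\<chi>\<close> Monsky's argument with the Lambert series \<open>\<Sum> \<chi>(n) x\<^sup>n / (1 - x\<^sup>n)\<close> applies.
\<close>

section \<open>Arithmetic of f and d\<close>

text \<open>Some unit has order exactly \<open>Carmichael m\<close>, so no smaller positive exponent
  can annihilate every unit.\<close>

lemma carmichael_eq_Carmichael:
  assumes "m > 0"
  shows "carmichael m = Carmichael m"
  unfolding carmichael_def
proof (rule Least_equality)
  show "Carmichael m > 0 \<and> (\<forall>a. coprime a m \<longrightarrow> [a ^ Carmichael m = 1] (mod m))"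
    using Carmichael_divides[OF dvd_refl, of m] by (auto simp: coprime_commute)
next
  fix k assume k: "k > 0 \<and> (\<forall>a. coprime a m \<longrightarrow> [a ^ k = 1] (mod m))"
  obtain g where g: "g \<in> totatives m" "ord m g = Carmichael m"
    using Carmichael_root_exists assms by metis
  hence "[g ^ k = 1] (mod m)"
    using k by (auto simp: totatives_def)
  hence "Carmichael m dvd k"
    using g(2) ord_divides by metis
  thus "Carmichael m \<le> k"
    using k by (auto intro: dvd_imp_le)
qed

text \<open>For m > 0 this is m / rad(m), written as a product over primes so that divisibility can
  be checked one prime power at a time.\<close>

definition nonrad :: "nat \<Rightarrow> nat" where
  "nonrad m = (\<Prod>p\<in>prime_factors m. p ^ (multiplicity p m - 1))"

lemma nonrad_pos: "nonrad m > 0"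
  unfolding nonrad_def by (rule prod_pos) (auto simp: prime_factors_multiplicity prime_gt_0_nat)

lemma totient_rad: "totient (rad m) = (\<Prod>p\<in>prime_factors m. p - 1)"
proof -
  have "totient (rad m) = (\<Prod>p\<in>prime_factors m. totient p)"
    unfolding rad_def
    by (rule totient_prod_coprime) (auto simp: pairwise_def in_prime_factors_iff primes_coprime)
  also have "\<dots> = (\<Prod>p\<in>prime_factors m. p - 1)"
    by (intro prod.cong) (auto simp: in_prime_factors_iff totient_prime)
  finally show ?thesis .
qed

lemma totient_eq_nonrad:
  assumes "m > 0"
  shows "totient m = nonrad m * totient (rad m)"
  by (subst totient_formula1) (use assms in \<open>simp_all add: nonrad_def totient_rad prod.distrib\<close>)

text \<open>Cancelling phi(rad m) leaves delta lambda(m) / (m / rad m), a quotient whose valuations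
  at each prime can be read off.\<close>

lemma ffun_eq:
  assumes "m > 0"
  shows "ffun m = gcd m ((delta m * Carmichael m) div nonrad m)"
proof -
  have "totient (rad m) > 0"
    unfolding totient_rad
    by (intro prod_pos) (auto simp: in_prime_factors_iff dest: prime_gt_1_nat)
  thus ?thesis
    by (simp add: ffun_def carmichael_eq_Carmichael[OF assms] totient_eq_nonrad[OF assms])
qed

lemma prod_coprime_dvd:
  fixes f :: "'a \<Rightarrow> nat"
  assumes "finite A" "\<And>x. x \<in> A \<Longrightarrow> f x dvd n"
    and "\<And>x y. x \<in> A \<Longrightarrow> y \<in> A \<Longrightarrow> x \<noteq> y \<Longrightarrow> coprime (f x) (f y)"
  shows "(\<Prod>x\<in>A. f x) dvd n"
  using assms
proof (induction A rule: finite_induct)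
  case (insert x A)
  have "coprime (f x) (\<Prod>x\<in>A. f x)"
    using insert by (intro prod_coprime_right) auto
  thus ?case
    using insert by (auto intro: divides_mult)
qed auto

text \<open>If p^k exactly divides m, then p^(k-1) divides lambda(p^k), except that lambda(2^k) is
  only 2^(k-2) for k >= 3. In that case 4 divides m and delta = 2 restores the missing
  factor.\<close>

lemma nonrad_dvd_Carmichael:
  assumes "m > 0"
  shows "nonrad m dvd delta m * Carmichael m"
  unfolding nonrad_def
proof (rule prod_coprime_dvd)
  fix p assume p: "p \<in> prime_factors m"
  define k where "k = multiplicity p m"
  have prime: "prime p" and "k > 0"
    using p by (auto simp: k_def prime_factors_multiplicity)
  obtain m' where m': "m = p ^ k * m'"
    using multiplicity_dvd unfolding k_def by blast
  have "\<not> p dvd m'"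
    using m' prime assms multiplicity_decompose[of m p]
    by (metis k_def mult_left_cancel not_prime_unit not_gr_zero nonzero_mult_div_cancel_left power_eq_0_iff prime_gt_0_nat)
  hence "Carmichael m = lcm (Carmichael (p ^ k)) (Carmichael m')"
    unfolding m' by (intro Carmichael_mult_coprime) (use prime in \<open>simp add: prime_imp_coprime\<close>)
  hence dvd: "Carmichael (p ^ k) dvd Carmichael m"
    by simp
  show "p ^ (multiplicity p m - 1) dvd delta m * Carmichael m"
  proof (cases "p = 2 \<and> k \<ge> 2")
    case True
    hence "4 dvd p ^ k"
      using le_imp_power_dvd[of 2 k "2::nat"] by simp
    hence "delta m = 2"
      by (simp add: delta_def m')
    moreover have "2 ^ (k - 1) dvd 2 * Carmichael (2 ^ k)"
    proof (cases "k = 2")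
      case False
      hence "k - 1 = Suc (k - 2)" using True by linarith
      thus ?thesis using False True by (simp add: Carmichael_twopow)
    qed auto
    ultimately show ?thesis
      using True dvd by (metis dvd_trans k_def mult_dvd_mono dvd_refl)
  next
    case False
    hence "p ^ (k - 1) dvd Carmichael (p ^ k)"
      using prime \<open>k > 0\<close> by (auto simp: Carmichael_prime_power not_le less_Suc_eq numeral_2_eq_2)
    thus ?thesis
      using dvd by (metis dvd_mult dvd_trans k_def)
  qed
qed (auto simp: in_prime_factors_iff primes_coprime intro!: coprime_power_left_iff[THEN iffD2] coprime_power_right_iff[THEN iffD2])

section \<open>Part (i): divisibility of f(m) and d(m) by powers of 2\<close>

lemma multiplicity_2_nonrad:
  assumes "m > 0"
  shows "multiplicity 2 (nonrad m) = multiplicity 2 m - 1"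
proof -
  have odd: "odd (\<Prod>p\<in>prime_factors m - {2}. p ^ (multiplicity p m - 1))"
  proof
    assume "even (\<Prod>p\<in>prime_factors m - {2}. p ^ (multiplicity p m - 1))"
    then obtain p where "p \<in> prime_factors m - {2}" "even (p ^ (multiplicity p m - 1))"
      by (auto simp: even_prod_iff)
    thus False
      using prime_odd_nat[of p] by (auto simp: in_prime_factors_iff le_less dest: prime_ge_2_nat)
  qed
  show ?thesis
  proof (cases "even m")
    case True
    hence "2 \<in> prime_factors m" using assms by (simp add: in_prime_factors_iff)
    hence "nonrad m = 2 ^ (multiplicity 2 m - 1) * (\<Prod>p\<in>prime_factors m - {2}. p ^ (multiplicity p m - 1))"
      unfolding nonrad_def by (simp add: prod.remove)
    thus ?thesis
      using odd by (simp add: multiplicity_eqI multiplicity_prime_elem_times_other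
           prime_elem_multiplicity_mult_distrib not_dvd_imp_multiplicity_0 multiplicity_same_power)
  next
    case False
    hence "prime_factors m - {2} = prime_factors m" by (auto simp: in_prime_factors_iff)
    thus ?thesis using odd False by (simp add: nonrad_def not_dvd_imp_multiplicity_0)
  qed
qed


text \<open>Let 2^k exactly divide m, so k is 1 or 2. The odd prime factor gives m > 2, hence
  lambda(m) is even, and delta adds a second factor 2 when k = 2. Thus 2^k divides delta lambda(m),
  while \<open>nonrad m\<close> absorbs only 2^(k-1).\<close>

lemma even_ffun:
  assumes "m > 0" "even m" "\<not> 8 dvd m" "prime r" "odd r" "r dvd m"
  shows "even (ffun m)"
proof -
  have "m > 2"
    using assms by (metis dvd_imp_le dvd_antisym le_neq_implies_less nat_dvd_not_less prime_ge_2_nat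
      primes_dvd_imp_eq two_is_prime_nat order_le_less)
  hence even: "even (Carmichael m)"
    by (rule even_Carmichael)
  define k where "k = multiplicity 2 m"
  have "k > 0" using assms by (simp add: k_def multiplicity_gt_zero_iff)
  have "\<not> 2 ^ 3 dvd m" using assms by simp
  hence "k < 3"
    using assms unfolding k_def by (metis power_dvd_iff_le_multiplicity not_le not_prime_unit two_is_prime_nat neq0_conv)
  have dvd: "2 ^ k dvd delta m * Carmichael m"
  proof (cases "k = 1")
    case False
    hence "k = 2" using \<open>k > 0\<close> \<open>k < 3\<close> by linarith
    hence "2 ^ 2 dvd m" unfolding k_def by (metis multiplicity_dvd)
    hence "delta m = 2" by (simp add: delta_def)
    thus ?thesis using even \<open>k = 2\<close> by (simp add: power2_eq_square)
  qed (use even in simp)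
  define g where "g = (delta m * Carmichael m) div nonrad m"
  have g: "delta m * Carmichael m = g * nonrad m"
    using nonrad_dvd_Carmichael[OF assms(1)] by (simp add: g_def)
  have "\<not> 2 ^ k dvd nonrad m"
    using multiplicity_2_nonrad[OF assms(1)] nonrad_pos[of m] \<open>k > 0\<close>
    by (subst power_dvd_iff_le_multiplicity) (auto simp: k_def)
  hence "even g"
    using dvd unfolding g by (metis coprime_dvd_mult_right_iff coprime_power_left_iff coprime_left_2_iff_odd)
  thus ?thesis
    using assms by (simp add: ffun_eq g_def)
qed

text \<open>If 8 divided m, then \<open>r\<close> would divide t - 1 for some prime t dividing m.
  The distinct odd primes \<open>r\<close> and t each put an even factor into phi(rad m), and delta
  = 2 supplies the third factor 2 of d(m).\<close>

lemma not_8_dvd_if_not_8_dvd_dfun: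
  assumes "m > 0" "\<not> 8 dvd dfun m" "prime r" "odd r" "r dvd dfun m"
  shows "\<not> 8 dvd m"
proof
  assume "8 dvd m"
  hence "4 dvd m" by (rule dvd_trans[rotated]) simp
  hence dfun: "dfun m = gcd m (2 * totient (rad m))"
    by (simp add: dfun_def delta_def)
  have "r dvd m" "r dvd 2 * totient (rad m)"
    using assms(5) by (auto simp: dfun)
  hence "r dvd totient (rad m)"
    using assms by (metis prime_dvd_mult_iff primes_dvd_imp_eq two_is_prime_nat even_numeral)
  then obtain t where t: "t \<in> prime_factors m" "r dvd t - 1"
    using assms(3) unfolding totient_rad by (auto simp: prime_dvd_prod_iff)
  have r: "r \<in> prime_factors m"
    using assms \<open>r dvd m\<close> by (simp add: in_prime_factors_iff)
  have "prime t" using t by auto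
  have "t \<noteq> 2" using t assms by auto
  hence "odd t" using \<open>prime t\<close> by (metis prime_odd_nat prime_ge_2_nat order_le_less)
  have "t \<noteq> r"
    using t(2) \<open>prime t\<close> by (metis dvd_imp_le not_less diff_less prime_gt_0_nat prime_gt_1_nat zero_less_diff zero_less_one)
  have "2 * 2 dvd (t - 1) * (r - 1)"
    using \<open>odd t\<close> \<open>odd r\<close> by (intro mult_dvd_mono) auto
  also have "(t - 1) * (r - 1) = (\<Prod>p\<in>{t, r}. p - 1)"
    using \<open>t \<noteq> r\<close> by simp
  also have "\<dots> dvd totient (rad m)"
    unfolding totient_rad using t r by (intro prod_dvd_prod_subset) auto
  finally have "2 * 4 dvd 2 * totient (rad m)"
    by (intro mult_dvd_mono) auto
  hence "8 dvd dfun m" using \<open>8 dvd m\<close> by (simp add: dfun)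
  thus False using assms by simp
qed

text \<open>For odd n the numbers 2n and 4n are even but not divisible by 8. So m is even, has an
  odd prime factor and is not divisible by 8, which makes f(m) even.\<close>

lemma ffun_dfun_odd_impossible:
  assumes "odd n" "n > 1" "m > 0" "ffun m = n" "dfun m = 2 * n \<or> dfun m = 4 * n"
  shows False
proof -
  obtain r where r: "prime r" "r dvd n"
    using assms by (metis prime_factor_nat less_irrefl)
  have "odd r" using r assms by (meson dvd_trans)
  have "r dvd dfun m" using r assms by auto
  have "\<not> 8 dvd dfun m"
  proof
    assume "8 dvd dfun m"
    with assms(5) have "even n"
      by (elim disjE) presburger+
    thus False using assms by simp
  qed
  hence "\<not> 8 dvd m"
    using not_8_dvd_if_not_8_dvd_dfun assms r \<open>odd r\<close> \<open>r dvd dfun m\<close> by blast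
  moreover have "even m" "r dvd m"
    using assms(5) \<open>r dvd dfun m\<close> unfolding dfun_def
    by (metis dvd_trans dvd_triv_left even_mult_iff even_numeral gcd_dvd1, metis dvd_trans gcd_dvd1)
  ultimately have "even (ffun m)"
    using even_ffun assms r \<open>odd r\<close> by blast
  thus False using assms by simp
qed

text \<open>Write q - 1 = pB with p not dividing B, A = p - 1 and C = r - 1. For m = p^2 q r one has
  \<open>nonrad m\<close> = p, phi(rad m) = pABC and lambda(m) = pK with K dividing ABC. Since ABC
  is coprime to p and r, and q divides r - 1, the gcds are gcd(m, K) = q and gcd(m, pABC) =
  pq.\<close>

lemma ffun_dfun_construction:
  fixes p q r :: nat
  assumes primes: "prime p" "prime q" "prime r" and "odd p" "p < q" "q < r"
    and "p dvd q - 1" "\<not> p\<^sup>2 dvd q - 1" "q dvd r - 1" "\<not> p dvd r - 1"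
  shows "ffun (p\<^sup>2 * q * r) = q" "dfun (p\<^sup>2 * q * r) = p * q"
proof -
  define m where "m = p\<^sup>2 * q * r"
  define A where "A = p - 1"
  define B where "B = (q - 1) div p"
  define C where "C = r - 1"
  have pos: "p > 1" "q > 1" "r > 1" using primes prime_gt_1_nat by auto
  have B: "q - 1 = p * B" using assms by (simp add: B_def)
  have m: "m > 0" using pos by (simp add: m_def)
  have "odd q" "odd r"
    using assms pos by (metis prime_odd_nat not_less_iff_gr_or_eq prime_ge_2_nat order_le_less less_trans)+
  hence delta: "delta m = 1"
    using \<open>odd p\<close> by (auto simp: delta_def m_def dest: dvd_trans[of 2 4, rotated])
  have pf: "prime_factors m = {p, q, r}"
    using primes pos by (auto simp: m_def prime_factorization_mult prime_factorization_prime_power prime_factorization_prime)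
  have tot_rad: "totient (rad m) = A * (p * B) * C"
    unfolding totient_rad pf using assms by (simp add: A_def B C_def flip: B)
  have coprime: "coprime p q" "coprime p r" "coprime q r"
    using assms by (auto intro!: primes_coprime)
  have "totient m = p * (A * (p * B) * C)"
    using primes coprime B
    by (simp add: m_def totient_mult_coprime totient_prime_power totient_prime A_def C_def)
  moreover have "A * (p * B) * C > 0"
    using pos \<open>p < q\<close> by (simp add: A_def C_def flip: B)
  ultimately have nonrad: "nonrad m = p"
    using totient_eq_nonrad[OF m] tot_rad by (metis mult_right_cancel not_gr_zero)
  have "\<not> p dvd B"
    using assms(8) unfolding B power2_eq_square by auto
  have "\<not> p dvd A" "\<not> r dvd A" "\<not> r dvd C" "\<not> r dvd q - 1"
    using assms pos by (auto simp: A_def C_def dest!: dvd_imp_le)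
  hence "\<not> r dvd B" by (metis B dvd_mult)
  have cp: "coprime p (A * B * C)" "coprime r (A * B * C)"
    using primes \<open>\<not> p dvd B\<close> \<open>\<not> p dvd A\<close> \<open>\<not> r dvd A\<close> \<open>\<not> r dvd C\<close> \<open>\<not> r dvd B\<close> assms(10)
    by (simp_all add: C_def prime_imp_coprime prime_dvd_mult_iff)
  have Car: "Carmichael m = lcm (lcm (p * A) (p * B)) C"
    using primes coprime Carmichael_odd_prime_power[of p 2] \<open>odd p\<close> B
    by (simp add: m_def Carmichael_mult_coprime Carmichael_prime A_def C_def)
  define K where "K = Carmichael m div p"
  have K: "Carmichael m = p * K"
    unfolding K_def Car by (metis dvd_lcmI1 dvd_mult_div_cancel dvd_trans dvd_triv_left)
  have "Carmichael m dvd p * (A * B * C)"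
    unfolding Car by (intro lcm_least) (auto intro: mult_dvd_mono)
  hence KABC: "K dvd A * B * C"
    using pos by (simp add: K)
  have "q dvd p * K"
    using assms(9) unfolding K[symmetric] Car C_def by (meson dvd_lcmI2 dvd_trans)
  hence "q dvd K"
    using coprime by (metis coprime_commute coprime_dvd_mult_right_iff)
  have "coprime (p\<^sup>2 * r) K"
    using cp KABC by (auto intro: coprime_divisors[OF dvd_refl])
  hence "gcd (p\<^sup>2 * r * q) K = gcd q K"
    by (simp add: gcd_mult_left_left_cancel coprime_commute)
  also have "\<dots> = q" using \<open>q dvd K\<close> by (simp add: gcd_nat.absorb1)
  finally have "gcd m K = q" by (simp add: m_def mult_ac)
  thus "ffun (p\<^sup>2 * q * r) = q"
    using ffun_eq[OF m] unfolding m_def[symmetric] by (simp add: delta nonrad K_def)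
  have "q dvd A * B * C" using \<open>q dvd K\<close> KABC by (rule dvd_trans)
  moreover have "gcd (p * r * q) (A * B * C) = gcd q (A * B * C)"
    using cp by (simp add: gcd_mult_left_left_cancel coprime_commute)
  ultimately have "gcd (p * r * q) (A * B * C) = q"
    by (simp add: gcd_nat.absorb1)
  hence "gcd (p * (p * r * q)) (p * (A * B * C)) = p * q"
    by (metis gcd_mult_distrib_nat)
  thus "dfun (p\<^sup>2 * q * r) = p * q"
    unfolding m_def[symmetric] dfun_def delta tot_rad
    by (simp add: m_def mult_ac power2_eq_square)
qed

section \<open>Euler products\<close>

text \<open>A Dirichlet series at a real point. The index 0 contributes nothing because
  \<open>0 powr x = 0\<close>.\<close>

definition Lfun :: "(nat \<Rightarrow> complex) \<Rightarrow> real \<Rightarrow> complex" where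
  "Lfun f s = (\<Sum>n. f n * of_real (real n powr -s))"

definition prime_sum :: "(nat \<Rightarrow> complex) \<Rightarrow> real \<Rightarrow> complex" where
  "prime_sum f s = (\<Sum>n. if prime n then f n * of_real (real n powr -s) else 0)"

text \<open>Complete multiplicativity without periodicity, and with \<open>f 0\<close> left free,
  covers characters, their products for different moduli, and the constant 1 that yields
  zeta.\<close>

locale mult_bounded =
  fixes f :: "nat \<Rightarrow> complex"
  assumes f_1: "f (Suc 0) = 1"
    and f_mult: "f (m * n) = f m * f n"
    and norm_f_le: "norm (f n) \<le> 1"
begin

lemma norm_term_le: "norm (f n * of_real (real n powr -s)) \<le> real n powr -s"
  using mult_mono[OF norm_f_le[of n] order.refl, of "real n powr -s"] by (simp add: norm_mult)

lemma summable_restrict: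
  assumes "s > 1"
  shows "summable (\<lambda>n. if Q n then f n * of_real (real n powr -s) else 0)"
proof (rule summable_comparison_test)
  show "\<exists>N. \<forall>n\<ge>N. norm (if Q n then f n * of_real (real n powr -s) else 0) \<le> real n powr -s"
    using norm_term_le by (auto intro!: exI[of _ 0])
  show "summable (\<lambda>n. real n powr -s)"
    using assms by (simp add: summable_real_powr_iff)
qed

text \<open>The sieve of Eratosthenes: multiplying by 1 - f(p) p^(-s) deletes exactly the terms
  whose index is a multiple of p.\<close>

lemma Lfun_mult_euler_factors:
  assumes "s > 1" "finite A" "\<And>p. p \<in> A \<Longrightarrow> prime p"
  shows "Lfun f s * (\<Prod>p\<in>A. 1 - f p * of_real (real p powr -s)) =
         (\<Sum>n. if \<forall>p\<in>A. \<not> p dvd n then f n * of_real (real n powr -s) else 0)"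
  using assms(2,3)
proof (induction A rule: finite_induct)
  case empty
  thus ?case by (simp add: Lfun_def)
next
  case (insert p A)
  define t where "t n = f n * of_real (real n powr -s)" for n
  define F where "F n = (if \<forall>p\<in>A. \<not> p dvd n then t n else 0)" for n
  have p: "prime p" "p > 0" using insert prime_gt_0_nat by auto
  have t_mult: "t (m * n) = t m * t n" for m n
    by (simp add: t_def f_mult powr_mult)
  have sum_F: "summable (\<lambda>n. if Q n then F n else 0)" for Q
  proof -
    have "(\<lambda>n. if Q n then F n else 0) = (\<lambda>n. if Q n \<and> (\<forall>p\<in>A. \<not> p dvd n) then t n else 0)"
      by (auto simp: F_def)
    thus ?thesis
      using summable_restrict[OF assms(1), of "\<lambda>n. Q n \<and> (\<forall>p\<in>A. \<not> p dvd n)"]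
      unfolding t_def by simp
  qed
  \<comment> \<open>A new prime p outside \<open>A\<close> does not change which primes of
    \<open>A\<close> divide n, so the sieved coefficients still scale by \<open>t p\<close>.\<close>
  have F_mult: "F (p * n) = t p * F n" for n
  proof -
    have "q dvd p * n \<longleftrightarrow> q dvd n" if "q \<in> A" for q
      using insert that p by (metis dvd_mult prime_dvd_multD primes_dvd_imp_eq insertCI)
    thus ?thesis by (simp add: F_def t_mult)
  qed
  have "t p * suminf F = (\<Sum>n. F (p * n))"
    using sum_F[of "\<lambda>_. True"] by (simp add: F_mult suminf_mult)
  \<comment> \<open>The summand is rewritten to be supported on multiples of p, so that reindexing
    along n -> pn loses nothing.\<close>
  also have "\<dots> = (\<Sum>n. (\<lambda>n. if p dvd n then F n else 0) (p * n))"
    by simp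
  also have "\<dots> = (\<Sum>n. if p dvd n then F n else 0)"
    by (rule suminf_mono_reindex) (use p in \<open>auto simp: strict_mono_def dvd_def\<close>)
  finally have "suminf F * (1 - t p) = suminf F - (\<Sum>n. if p dvd n then F n else 0)"
    by (simp add: algebra_simps)
  also have "\<dots> = (\<Sum>n. F n - (if p dvd n then F n else 0))"
    using sum_F[of "\<lambda>_. True"] sum_F[of "\<lambda>n. p dvd n"] by (simp add: suminf_diff)
  also have "(\<lambda>n. F n - (if p dvd n then F n else 0)) = (\<lambda>n. if \<forall>q\<in>insert p A. \<not> q dvd n then t n else 0)"
    by (auto simp: F_def)
  finally have *: "suminf F * (1 - t p) = (\<Sum>n. if \<forall>q\<in>insert p A. \<not> q dvd n then t n else 0)" .
  have IH: "Lfun f s * (\<Prod>p\<in>A. 1 - t p) = suminf F"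
    using insert unfolding F_def t_def by blast
  show ?case
    unfolding t_def[symmetric] *[symmetric] IH[symmetric] using insert.hyps by (simp add: mult_ac)
qed

text \<open>After sieving by all primes below N only n = 1 and indices n >= N survive, so the
  distance to 1 is at most a tail of the sum of n^(-s).\<close>

lemma euler_product_tendsto:
  assumes "s > 1"
  shows "(\<lambda>N. Lfun f s * (\<Prod>p | prime p \<and> p < N. 1 - f p * of_real (real p powr -s))) \<longlonglongrightarrow> 1"
proof -
  define t where "t n = f n * of_real (real n powr -s)" for n
  define T where "T N n = (if \<forall>p\<in>{p. prime p \<and> p < N}. \<not> p dvd n then t n else 0)" for N n
  have summ: "summable (\<lambda>n. real n powr -s)"
    using assms by (simp add: summable_real_powr_iff)
  have T: "Lfun f s * (\<Prod>p | prime p \<and> p < N. 1 - f p * of_real (real p powr -s)) = suminf (T N)" for N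
    unfolding T_def t_def by (rule Lfun_mult_euler_factors) (use assms in auto)
  have summT: "summable (T N)" for N
    unfolding T_def t_def by (rule summable_restrict[OF assms])
  have bound: "norm (suminf (T N) - 1) \<le> (\<Sum>n. real (n + N) powr -s)" if "N > 1" for N
  proof -
    have zero: "T N n = (if n = 1 then 1 else 0)" if "n < N" for n
    proof (cases "n \<le> 1")
      case True
      hence "n = 0 \<or> n = 1" by auto
      thus ?thesis by (auto simp: T_def t_def f_1)
    next
      case False
      then obtain p where "prime p" "p dvd n" by (metis prime_factor_nat le_refl)
      moreover from this False that have "p < N" by (metis dvd_imp_le le_less_trans not_le less_one order_less_trans)
      ultimately show ?thesis using False by (auto simp: T_def)
    qed
    have "suminf (T N) = (\<Sum>n. T N (n + N)) + (\<Sum>n<N. T N n)"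
      by (rule suminf_split_initial_segment[OF summT])
    also have "(\<Sum>n<N. T N n) = (\<Sum>n<N. if n = 1 then 1 else 0)"
      by (intro sum.cong) (use zero in auto)
    also have "\<dots> = 1" using that by simp
    finally have "norm (suminf (T N) - 1) = norm (\<Sum>n. T N (n + N))" by simp
    also have "\<dots> \<le> (\<Sum>n. real (n + N) powr -s)"
    proof (rule norm_suminf_le)
      show "norm (T N (n + N)) \<le> real (n + N) powr -s" for n
        using norm_term_le[of "n + N" s] by (auto simp: T_def t_def simp del: of_nat_add)
      show "summable (\<lambda>n. real (n + N) powr -s)"
        using summable_iff_shift[of "\<lambda>n. real n powr -s" N] summ by simp
    qed
    finally show ?thesis .
  qed
  have "(\<lambda>N. (\<Sum>n. real n powr -s) - (\<Sum>n<N. real n powr -s)) \<longlonglongrightarrow> (\<Sum>n. real n powr -s) - (\<Sum>n. real n powr -s)"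
    by (intro tendsto_diff tendsto_const summable_LIMSEQ summ)
  hence lim: "(\<lambda>N. \<Sum>n. real (n + N) powr -s) \<longlonglongrightarrow> 0"
    using suminf_minus_initial_segment[OF summ] by simp
  have "(\<lambda>N. suminf (T N) - 1) \<longlonglongrightarrow> 0"
    by (rule Lim_null_comparison[OF _ lim])
       (use bound in \<open>auto intro!: eventually_sequentiallyI[of 2]\<close>)
  thus ?thesis
    unfolding T by (simp add: LIM_zero_iff)
qed

end

section \<open>Comparison of |L(f, s)| with the exponential of a sum over primes\<close>

lemma norm_one_minus_bounds:
  fixes z :: complex
  assumes "norm z \<le> 1 / 2"
  shows "exp (- Re z - 2 * (norm z)\<^sup>2) \<le> norm (1 - z)"
    and "norm (1 - z) \<le> exp (- Re z + 2 * (norm z)\<^sup>2)"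
proof -
  have nz: "1 - z \<noteq> 0" using assms by auto
  \<comment> \<open>The principal logarithm satisfies ln(1 - z) = -z up to |z|^2 / (1 - |z|), and
    |z| <= 1/2 turns this error into 2 |z|^2.\<close>
  have "norm (ln (1 + (-z)) - (-z)) \<le> (norm (-z))\<^sup>2 / (1 - norm (-z))"
    by (rule Ln_approx_linear) (use assms in auto)
  also have "\<dots> \<le> (norm z)\<^sup>2 / (1 / 2)"
    using assms by (intro frac_le) auto
  finally have "norm (ln (1 - z) + z) \<le> 2 * (norm z)\<^sup>2"
    by simp
  hence "\<bar>Re (ln (1 - z) + z)\<bar> \<le> 2 * (norm z)\<^sup>2"
    using abs_Re_le_cmod order_trans by blast
  hence *: "\<bar>ln (norm (1 - z)) + Re z\<bar> \<le> 2 * (norm z)\<^sup>2"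
    using nz by (simp add: Re_Ln)
  have "norm (1 - z) = exp (ln (norm (1 - z)))" using nz by simp
  thus "exp (- Re z - 2 * (norm z)\<^sup>2) \<le> norm (1 - z)"
       "norm (1 - z) \<le> exp (- Re z + 2 * (norm z)\<^sup>2)"
    using * by (metis abs_le_iff exp_le_cancel_iff add.commute diff_le_eq le_diff_eq minus_add_distrib
      minus_diff_eq uminus_add_conv_diff, smt (verit) exp_le_cancel_iff)
qed

lemma sum_inverse_squares_le:
  "(\<Sum>n\<in>{2..N}. 1 / (real n)\<^sup>2) \<le> 1"
proof -
  \<comment> \<open>The stronger bound with -1/N carries the induction, through the telescoping
    estimate of 1/(n+1)^2.\<close>
  have "(\<Sum>n\<in>{2..N}. 1 / (real n)\<^sup>2) \<le> 1 - 1 / real N" if "N \<ge> 1"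
    using that
  proof (induction N rule: dec_induct)
    case (step n)
    have "1 / (real (Suc n))\<^sup>2 \<le> 1 / (real n * real (Suc n))"
      using step by (intro divide_left_mono) (auto simp: power2_eq_square)
    also have "\<dots> = 1 / real n - 1 / real (Suc n)"
      using step by (simp add: field_simps)
    finally have "1 / (real (Suc n))\<^sup>2 \<le> 1 / real n - 1 / real (Suc n)" .
    thus ?case using step by (simp add: atLeastAtMostSuc_conv)
  qed auto
  thus ?thesis
    by (cases "N \<ge> 1") (auto intro: order_trans)
qed

context mult_bounded
begin

text \<open>This replaces log L(f, s) and needs no branch of the logarithm. The errors 2 |t(p)|^2
  add up to at most 2 because |t(p)| <= 1/p, so the factors exp(2) and exp(-2) are uniform in s and
  f.\<close>

lemma Lfun_bounds:
  assumes "s > 1"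
  shows "exp (Re (prime_sum f s) - 2) \<le> norm (Lfun f s)"
    and "norm (Lfun f s) \<le> exp (Re (prime_sum f s) + 2)"
proof -
  define t where "t n = f n * of_real (real n powr -s)" for n
  define P where "P N = (\<Sum>p | prime p \<and> p < N. t p)" for N
  define E where "E N = (\<Prod>p | prime p \<and> p < N. 1 - t p)" for N
  have t_le: "norm (t p) \<le> 1 / real p" if "p > 0" for p
  proof -
    have "norm (t p) \<le> real p powr -s" unfolding t_def by (rule norm_term_le)
    also have "\<dots> \<le> real p powr -1" using that assms by (intro powr_mono) auto
    finally show ?thesis using that by (simp add: powr_minus_divide)
  qed
  have sq: "(\<Sum>p | prime p \<and> p < N. 2 * (norm (t p))\<^sup>2) \<le> 2" for N
  proof -
    have "(\<Sum>p | prime p \<and> p < N. 2 * (norm (t p))\<^sup>2) \<le> (\<Sum>p | prime p \<and> p < N. 2 * (1 / (real p)\<^sup>2))"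
    proof (intro sum_mono mult_left_mono)
      fix p assume "p \<in> {p. prime p \<and> p < N}"
      hence "(norm (t p))\<^sup>2 \<le> (1 / real p)\<^sup>2"
        by (intro power_mono t_le) (auto simp: prime_gt_0_nat)
      thus "(norm (t p))\<^sup>2 \<le> 1 / (real p)\<^sup>2" by (simp add: power_divide)
    qed auto
    also have "\<dots> \<le> (\<Sum>p\<in>{2..N}. 2 * (1 / (real p)\<^sup>2))"
      by (intro sum_mono2) (auto dest: prime_ge_2_nat)
    also have "\<dots> = 2 * (\<Sum>p\<in>{2..N}. 1 / (real p)\<^sup>2)"
      by (simp add: sum_distrib_left)
    also have "\<dots> \<le> 2" using sum_inverse_squares_le[of N] by simp
    finally show ?thesis .
  qed
  have half: "norm (t p) \<le> 1 / 2" if "prime p" for p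
  proof -
    have "norm (t p) \<le> 1 / real p" using that by (intro t_le prime_gt_0_nat)
    also have "\<dots> \<le> 1 / 2" using prime_ge_2_nat[OF that] by (intro divide_left_mono) auto
    finally show ?thesis .
  qed
  \<comment> \<open>\<open>E N\<close> is the reciprocal of the partial Euler product, hence the
    reversed sign of \<open>P N\<close>.\<close>
  have lower: "exp (- Re (P N) - 2) \<le> norm (E N)" for N
  proof -
    have "exp (- Re (P N) - 2) \<le> exp (\<Sum>p | prime p \<and> p < N. - Re (t p) - 2 * (norm (t p))\<^sup>2)"
      using sq[of N] by (simp add: P_def sum_subtractf sum_negf)
    also have "\<dots> = (\<Prod>p | prime p \<and> p < N. exp (- Re (t p) - 2 * (norm (t p))\<^sup>2))"
      by (rule exp_sum) auto
    also have "\<dots> \<le> (\<Prod>p | prime p \<and> p < N. norm (1 - t p))"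
      by (intro prod_mono conjI norm_one_minus_bounds half) auto
    finally show ?thesis by (simp add: E_def prod_norm)
  qed
  have upper: "norm (E N) \<le> exp (- Re (P N) + 2)" for N
  proof -
    have "norm (E N) = (\<Prod>p | prime p \<and> p < N. norm (1 - t p))"
      by (simp add: E_def prod_norm)
    also have "\<dots> \<le> (\<Prod>p | prime p \<and> p < N. exp (- Re (t p) + 2 * (norm (t p))\<^sup>2))"
      by (intro prod_mono conjI norm_one_minus_bounds half) auto
    also have "\<dots> = exp (\<Sum>p | prime p \<and> p < N. - Re (t p) + 2 * (norm (t p))\<^sup>2)"
      by (rule exp_sum [symmetric]) auto
    also have "(\<Sum>p | prime p \<and> p < N. - Re (t p) + 2 * (norm (t p))\<^sup>2) =
               - Re (P N) + (\<Sum>p | prime p \<and> p < N. 2 * (norm (t p))\<^sup>2)"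
      by (simp only: P_def sum.distrib sum_negf Re_sum)
    also have "exp \<dots> \<le> exp (- Re (P N) + 2)"
      using sq[of N] by simp
    finally show ?thesis .
  qed
  have P_lim: "P \<longlonglongrightarrow> prime_sum f s"
  proof -
    have "P = (\<lambda>N. \<Sum>n<N. if prime n then t n else 0)"
      by (auto simp: P_def fun_eq_iff simp flip: sum.inter_filter intro!: sum.cong)
    thus ?thesis
      using summable_LIMSEQ[OF summable_restrict[OF assms, of prime]]
      unfolding prime_sum_def t_def by simp
  qed
  have E_lim: "(\<lambda>N. norm (Lfun f s * E N)) \<longlonglongrightarrow> 1"
    using tendsto_norm[OF euler_product_tendsto[OF assms]] by (simp add: E_def t_def)
  have "norm (Lfun f s) * exp (- Re (prime_sum f s) - 2) \<le> 1"
  proof (rule LIMSEQ_le[OF _ E_lim])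
    show "(\<lambda>N. norm (Lfun f s) * exp (- Re (P N) - 2)) \<longlonglongrightarrow> norm (Lfun f s) * exp (- Re (prime_sum f s) - 2)"
      by (intro tendsto_intros P_lim)
    show "\<exists>N. \<forall>n\<ge>N. norm (Lfun f s) * exp (- Re (P n) - 2) \<le> norm (Lfun f s * E n)"
      using lower by (auto simp: norm_mult intro!: mult_left_mono)
  qed
  hence "norm (Lfun f s) * exp (- (Re (prime_sum f s) + 2)) \<le> 1"
    by simp
  thus "norm (Lfun f s) \<le> exp (Re (prime_sum f s) + 2)"
    by (simp only: exp_minus) (simp add: field_simps)
  have "1 \<le> norm (Lfun f s) * exp (- Re (prime_sum f s) + 2)"
  proof (rule LIMSEQ_le[OF E_lim])
    show "(\<lambda>N. norm (Lfun f s) * exp (- Re (P N) + 2)) \<longlonglongrightarrow> norm (Lfun f s) * exp (- Re (prime_sum f s) + 2)"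
      by (intro tendsto_intros P_lim)
    show "\<exists>N. \<forall>n\<ge>N. norm (Lfun f s * E n) \<le> norm (Lfun f s) * exp (- Re (P n) + 2)"
      using upper by (auto simp: norm_mult intro!: mult_left_mono)
  qed
  hence "1 \<le> norm (Lfun f s) * exp (- (Re (prime_sum f s) - 2))"
    by simp
  thus "exp (Re (prime_sum f s) - 2) \<le> norm (Lfun f s)"
    by (simp only: exp_minus) (simp add: field_simps)
qed

end

text \<open>Abel summation, stated with the total variation of g because the Lipschitz estimate at s
  = 1 uses n^(-1) - n^(-s), which is not monotone.\<close>

lemma summation_by_parts_suminf:
  fixes f :: "nat \<Rightarrow> complex" and g :: "nat \<Rightarrow> real"
  assumes B: "\<And>N. norm (\<Sum>n<N. f n) \<le> B"
    and summ: "summable (\<lambda>n. \<bar>g (Suc n) - g n\<bar>)" and lim: "g \<longlonglongrightarrow> 0"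
  shows "summable (\<lambda>n. f n * of_real (g n))"
    and "norm (\<Sum>n. f n * of_real (g n)) \<le> B * (\<Sum>n. \<bar>g (Suc n) - g n\<bar>)"
proof -
  define F where "F N = (\<Sum>n<N. f n)" for N
  define h where "h n = F (Suc n) * of_real (g (Suc n) - g n)" for n
  have h_le: "norm (h n) \<le> B * \<bar>g (Suc n) - g n\<bar>" for n
    unfolding h_def norm_mult norm_of_real F_def by (intro mult_right_mono B) auto
  have summ': "summable (\<lambda>n. B * \<bar>g (Suc n) - g n\<bar>)" by (intro summable_mult summ)
  have summ_h: "summable h"
    by (rule summable_comparison_test'[OF summ', of 0]) (use h_le in auto)
  have parts: "(\<Sum>n<N. f n * of_real (g n)) = F N * of_real (g N) - (\<Sum>n<N. h n)" for N
    by (induction N) (simp_all add: F_def h_def algebra_simps)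
  have "(\<lambda>N. F N * of_real (g N)) \<longlonglongrightarrow> 0"
  proof (rule Lim_null_comparison)
    show "\<forall>\<^sub>F N in sequentially. norm (F N * of_real (g N)) \<le> B * \<bar>g N\<bar>"
      using B by (auto simp: F_def norm_mult intro!: mult_right_mono always_eventually)
    show "(\<lambda>N. B * \<bar>g N\<bar>) \<longlonglongrightarrow> 0"
      using tendsto_mult_right_zero[OF tendsto_rabs_zero[OF lim]] by simp
  qed
  hence "(\<lambda>N. F N * of_real (g N) - (\<Sum>n<N. h n)) \<longlonglongrightarrow> 0 - suminf h"
    by (intro tendsto_diff summable_LIMSEQ summ_h)
  hence sums: "(\<lambda>n. f n * of_real (g n)) sums (- suminf h)"
    unfolding sums_def parts by simp
  thus "summable (\<lambda>n. f n * of_real (g n))" by (rule sums_summable)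
  have "norm (suminf h) \<le> (\<Sum>n. B * \<bar>g (Suc n) - g n\<bar>)"
    by (rule norm_suminf_le[OF h_le summ'])
  also have "\<dots> = B * (\<Sum>n. \<bar>g (Suc n) - g n\<bar>)" by (rule suminf_mult[OF summ])
  finally show "norm (\<Sum>n. f n * of_real (g n)) \<le> B * (\<Sum>n. \<bar>g (Suc n) - g n\<bar>)"
    using sums by (simp add: sums_iff)
qed

lemma summation_by_parts_antimono:
  fixes f :: "nat \<Rightarrow> complex" and g :: "nat \<Rightarrow> real"
  assumes B: "\<And>N. norm (\<Sum>n<N. f n) \<le> B"
    and mono: "\<And>n. g (Suc n) \<le> g n" and lim: "g \<longlonglongrightarrow> 0"
  shows "summable (\<lambda>n. f n * of_real (g n))"
    and "norm (\<Sum>n. f n * of_real (g n)) \<le> B * g 0"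
proof -
  have eq: "(\<lambda>n. \<bar>g (Suc n) - g n\<bar>) = (\<lambda>n. g n - g (Suc n))"
    using mono by (auto simp: fun_eq_iff abs_if not_less intro: antisym)
  have "(\<lambda>n. \<bar>g (Suc n) - g n\<bar>) sums g 0"
    using telescope_sums'[OF lim] unfolding eq by simp
  thus "summable (\<lambda>n. f n * of_real (g n))" "norm (\<Sum>n. f n * of_real (g n)) \<le> B * g 0"
    using summation_by_parts_suminf[OF B _ lim] by (simp_all add: sums_iff)
qed

section \<open>L-series near 1\<close>

text \<open>The mean value theorem for x^(1-s). It serves as the integral test, with telescoping
  differences in place of integrals.\<close>

lemma powr_neg_between:
  fixes s :: real
  assumes "s > 1" "n \<ge> 1"
  shows "(s - 1) * real (Suc n) powr -s \<le> real n powr (1 - s) - real (Suc n) powr (1 - s)"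
    and "real n powr (1 - s) - real (Suc n) powr (1 - s) \<le> (s - 1) * real n powr -s"
proof -
  have "\<exists>z>real n. z < real (Suc n) \<and>
      real (Suc n) powr (1 - s) - real n powr (1 - s) = (real (Suc n) - real n) * ((1 - s) * z powr (1 - s - 1))"
  proof (rule MVT2)
    show "((\<lambda>x. x powr (1 - s)) has_real_derivative (1 - s) * x powr (1 - s - 1)) (at x)"
      if "real n \<le> x" for x
      using that assms by (intro has_real_derivative_powr) auto
  qed auto
  then obtain z where z: "z > real n" "z < real (Suc n)"
    and eq: "real n powr (1 - s) - real (Suc n) powr (1 - s) = (s - 1) * z powr -s"
    by (auto simp: algebra_simps)
  have "real (Suc n) powr -s \<le> z powr -s" "z powr -s \<le> real n powr -s"
    using z assms by (auto intro!: powr_mono2')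
  thus "(s - 1) * real (Suc n) powr -s \<le> real n powr (1 - s) - real (Suc n) powr (1 - s)"
       "real n powr (1 - s) - real (Suc n) powr (1 - s) \<le> (s - 1) * real n powr -s"
    unfolding eq using assms by (auto intro!: mult_left_mono)
qed

text \<open>The series is zeta(s), and the bounds make its simple pole at 1 quantitative. For the
  upper bound the term n = 1 is split off before comparing with the telescoping series.\<close>

lemma powr_suminf_bounds:
  fixes s :: real
  assumes "s > 1"
  shows "1 / (s - 1) \<le> (\<Sum>n. real n powr -s)" "(\<Sum>n. real n powr -s) \<le> 1 + 1 / (s - 1)"
proof -
  define d where "d n = (real (Suc n) powr (1 - s) - real (Suc (Suc n)) powr (1 - s)) / (s - 1)" for n
  have lim: "(\<lambda>n. real (Suc n) powr (1 - s)) \<longlonglongrightarrow> 0"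
    using assms by real_asymp
  have d: "d sums (1 / (s - 1))"
    unfolding d_def using sums_divide[OF telescope_sums'[OF lim], of "s - 1"] by simp
  have summ: "summable (\<lambda>n. real n powr -s)"
    using assms by (simp add: summable_real_powr_iff)
  have summ1: "summable (\<lambda>n. real (Suc n) powr -s)"
    using summ by (subst summable_Suc_iff)
  have summ2: "summable (\<lambda>n. real (Suc (Suc n)) powr -s)"
    using summ1 summable_Suc_iff[of "\<lambda>n. real (Suc n) powr -s"] by blast
  have eq1: "(\<Sum>n. real n powr -s) = (\<Sum>n. real (Suc n) powr -s)"
    using suminf_split_head[OF summ] by simp
  have eq2: "(\<Sum>n. real (Suc n) powr -s) = 1 + (\<Sum>n. real (Suc (Suc n)) powr -s)"
    using suminf_split_head[OF summ1] by simp
  have "suminf d \<le> (\<Sum>n. real (Suc n) powr -s)"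
  proof (rule suminf_le)
    show "d n \<le> real (Suc n) powr -s" for n
      using powr_neg_between(2)[OF assms, of "Suc n"] assms by (simp add: d_def divide_le_eq mult.commute)
  qed (use d summ1 in \<open>auto simp: sums_iff\<close>)
  thus "1 / (s - 1) \<le> (\<Sum>n. real n powr -s)"
    using d by (simp add: eq1 sums_iff)
  have "(\<Sum>n. real (Suc (Suc n)) powr -s) \<le> suminf d"
  proof (rule suminf_le)
    show "real (Suc (Suc n)) powr -s \<le> d n" for n
      using powr_neg_between(1)[OF assms, of "Suc n"] assms by (simp add: d_def le_divide_eq mult.commute)
  qed (use d summ2 in \<open>auto simp: sums_iff\<close>)
  thus "(\<Sum>n. real n powr -s) \<le> 1 + 1 / (s - 1)"
    using d unfolding eq1 eq2 by (simp add: sums_iff)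
qed

lemma (in mult_bounded) norm_Lfun_le:
  assumes "s > 1"
  shows "norm (Lfun f s) \<le> 1 + 1 / (s - 1)"
proof -
  have "norm (Lfun f s) \<le> (\<Sum>n. real n powr -s)"
    unfolding Lfun_def using assms norm_term_le
    by (intro norm_suminf_le) (auto simp: summable_real_powr_iff)
  thus ?thesis using powr_suminf_bounds[OF assms] by linarith
qed

text \<open>Sieving zeta by the single prime q gives zeta(s) (1 - q^(-s)), and the Euler factor is
  at least 1/2.\<close>

lemma norm_Lfun_principal_ge:
  fixes q :: nat
  assumes "s > 1" "prime q" and f: "\<And>n. f n = (if q dvd n then 0 else 1)"
  shows "norm (Lfun f s) \<ge> 1 / (2 * (s - 1))"
proof -
  interpret one: mult_bounded "\<lambda>_. 1" by standard auto
  define Z where "Z = (\<Sum>n. real n powr -s)"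
  have Z: "Lfun (\<lambda>_. 1) s = of_real Z"
    using assms by (simp add: Lfun_def Z_def suminf_of_real summable_real_powr_iff)
  have "Lfun f s = (\<Sum>n. if \<forall>p\<in>{q}. \<not> p dvd n then 1 * of_real (real n powr -s) else 0)"
    unfolding Lfun_def by (intro arg_cong[where f = suminf]) (auto simp: f)
  also have "\<dots> = Lfun (\<lambda>_. 1) s * (\<Prod>p\<in>{q}. 1 - 1 * of_real (real p powr -s))"
    by (rule one.Lfun_mult_euler_factors [symmetric]) (use assms in auto)
  also have "\<dots> = of_real (Z * (1 - real q powr -s))"
    by (simp add: Z)
  finally have "norm (Lfun f s) = \<bar>Z * (1 - real q powr -s)\<bar>"
    by (simp only: norm_of_real)
  moreover have "real q powr -s \<le> 1 / 2"
  proof -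
    have "real q powr -s \<le> real q powr -1"
      using assms prime_gt_0_nat by (intro powr_mono) (auto simp: Suc_le_eq)
    also have "\<dots> \<le> 1 / 2"
      using prime_ge_2_nat[OF assms(2)] by (simp add: powr_minus_divide field_simps)
    finally show ?thesis .
  qed
  moreover have "1 / (s - 1) * (1 / 2) \<le> Z * (1 - real q powr -s)"
    using powr_suminf_bounds(1)[OF assms(1)] \<open>real q powr -s \<le> 1 / 2\<close> assms(1)
    unfolding Z_def[symmetric] by (intro mult_mono) (auto intro: order_trans[rotated])
  ultimately show ?thesis by (simp add: mult.commute)
qed

text \<open>By the mean value theorem the difference is s z^(-s-1) - z^(-2), which splits into (s-1)
  z^(-s-1) and -z^(-2) (1 - z^(-(s-1))). The second part is at most (s-1) z^(-2) ln z in absolute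
  value. Giving up half a power of z for the logarithm leaves the summable exponent -3/2.\<close>

lemma inverse_minus_powr_diff_le:
  fixes s :: real
  assumes s: "1 < s" and "n \<ge> 1"
  shows "\<bar>(real (Suc n) powr -1 - real (Suc n) powr -s) - (real n powr -1 - real n powr -s)\<bar>
           \<le> (s - 1) * (3 * real n powr - (3 / 2))"
proof -
  have "\<exists>z>real n. z < real (Suc n) \<and>
      (real (Suc n) powr -1 - real (Suc n) powr -s) - (real n powr -1 - real n powr -s) =
        (real (Suc n) - real n) * ((-1) * z powr (-1 - 1) - (-s) * z powr (-s - 1))"
  proof (rule MVT2)
    show "((\<lambda>x. x powr -1 - x powr -s) has_real_derivative
            (-1) * x powr (-1 - 1) - (-s) * x powr (-s - 1)) (at x)" if "real n \<le> x" for x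
      using that assms by (intro DERIV_diff has_real_derivative_powr) auto
  qed auto
  then obtain z where z: "z > real n" "z < real (Suc n)" and
    eq: "(real (Suc n) powr -1 - real (Suc n) powr -s) - (real n powr -1 - real n powr -s) =
       s * z powr (-s - 1) - z powr -2"
    by auto
  have z1: "z > 1" using z assms by linarith
  have "z powr (-2 + - (s - 1)) = z powr -2 * z powr - (s - 1)"
    by (rule powr_add)
  moreover have "-2 + - (s - 1) = -s - 1" by simp
  ultimately have "z powr (-s - 1) = z powr -2 * z powr - (s - 1)"
    by metis
  hence "s * z powr (-s - 1) - z powr -2 =
      (s - 1) * z powr (-s - 1) - z powr -2 * (1 - z powr - (s - 1))"
    by (simp add: algebra_simps)
  hence "\<bar>s * z powr (-s - 1) - z powr -2\<bar> \<le>
      \<bar>(s - 1) * z powr (-s - 1)\<bar> + \<bar>z powr -2 * (1 - z powr - (s - 1))\<bar>"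
    by linarith
  also have "\<bar>(s - 1) * z powr (-s - 1)\<bar> \<le> (s - 1) * z powr - (3 / 2)"
    using s z1 by (auto simp: abs_mult intro!: mult_left_mono powr_mono)
  also have "\<bar>z powr -2 * (1 - z powr - (s - 1))\<bar> \<le> (s - 1) * (2 * z powr - (3 / 2))"
  proof -
    have "z powr - (s - 1) \<le> 1" using powr_mono[of "- (s - 1)" 0 z] z1 s by simp
    have "z powr - (s - 1) = exp (- ((s - 1) * ln z))"
      using z1 by (simp add: powr_def algebra_simps)
    also have "\<dots> \<ge> 1 + (- ((s - 1) * ln z))" by (rule exp_ge_add_one_self)
    finally have "1 - z powr - (s - 1) \<le> (s - 1) * ln z" by simp
    moreover have "ln z \<le> 2 * z powr (1 / 2)"
    proof -
      have "ln (sqrt z) \<le> sqrt z - 1" using z1 by (intro ln_le_minus_one) auto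
      thus ?thesis using z1 by (simp add: ln_sqrt powr_half_sqrt)
    qed
    ultimately have "1 - z powr - (s - 1) \<le> (s - 1) * (2 * z powr (1 / 2))"
      using s by (meson less_imp_le diff_ge_0_iff_ge mult_left_mono order_trans)
    hence "z powr -2 * (1 - z powr - (s - 1)) \<le> z powr -2 * ((s - 1) * (2 * z powr (1 / 2)))"
      by (intro mult_left_mono) auto
    also have "\<dots> = (s - 1) * (2 * z powr - (3 / 2))"
      by (simp flip: powr_add add: algebra_simps)
    finally show ?thesis using \<open>z powr - (s - 1) \<le> 1\<close> by (simp add: abs_mult)
  qed
  also have "(s - 1) * z powr - (3 / 2) + (s - 1) * (2 * z powr - (3 / 2)) = (s - 1) * (3 * z powr - (3 / 2))"
    by (simp add: algebra_simps)
  also have "\<dots> \<le> (s - 1) * (3 * real n powr - (3 / 2))"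
    using s z assms by (intro mult_left_mono powr_mono2') auto
  finally show ?thesis unfolding eq by simp
qed

text \<open>An abstract nonprincipal character. \<open>k\<close> need only be a period, so the same
  estimates serve characters modulo q and their products with a character modulo p.\<close>

locale periodic_zero_sum = mult_bounded +
  fixes k :: nat
  assumes k_pos: "k > 0" and f_0: "f 0 = 0" and f_periodic: "f (n + k) = f n"
    and sum_period: "(\<Sum>n<k. f n) = 0"
begin

lemma norm_partial_sum_le: "norm (\<Sum>n<N. f n) \<le> real k"
proof (induction N rule: less_induct)
  case (less N)
  show ?case
  proof (cases "N \<le> k")
    case True
    have "norm (\<Sum>n<N. f n) \<le> (\<Sum>n<N. 1)"
      by (intro sum_norm_le norm_f_le)
    thus ?thesis using True by simp
  next
    case False
    have "{..<N} = {..<k} \<union> (\<lambda>n. n + k) ` {..<N - k}"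
    proof -
      have "n \<in> (\<lambda>n. n + k) ` {..<N - k}" if "n < N" "\<not> n < k" for n
        using that by (intro image_eqI[of _ _ "n - k"]) auto
      thus ?thesis using False by auto
    qed
    hence "(\<Sum>n<N. f n) = (\<Sum>n<k. f n) + (\<Sum>n\<in>(\<lambda>n. n + k) ` {..<N - k}. f n)"
      by (simp only:) (intro sum.union_disjoint, auto)
    also have "\<dots> = (\<Sum>n<N - k. f (n + k))"
      by (simp add: sum_period sum.reindex inj_on_def)
    also have "\<dots> = (\<Sum>n<N - k. f n)" by (simp add: f_periodic)
    finally show ?thesis using less[of "N - k"] False k_pos by simp
  qed
qed

lemma Lfun_nonprincipal:
  assumes "s \<ge> 1"
  shows "summable (\<lambda>n. f n * of_real (real n powr -s))" "norm (Lfun f s) \<le> real k"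
proof -
  \<comment> \<open>\<open>0 powr -s = 0\<close> would spoil monotonicity at the first index. Since
    f(0) = 0, the value there may be changed to 1.\<close>
  define g where "g n = (if n = 0 then 1 else real n powr -s)" for n
  have "(\<lambda>n. real n powr -s) \<longlonglongrightarrow> 0" using assms by real_asymp
  hence lim: "g \<longlonglongrightarrow> 0"
    by (rule Lim_transform_eventually) (auto simp: g_def intro!: eventually_sequentiallyI[of 1])
  have mono: "g (Suc n) \<le> g n" for n
    using assms by (auto simp: g_def intro!: powr_mono2' powr_le1 )
  have eq: "(\<lambda>n. f n * of_real (real n powr -s)) = (\<lambda>n. f n * of_real (g n))"
    by (auto simp: g_def f_0 fun_eq_iff)
  show "summable (\<lambda>n. f n * of_real (real n powr -s))" "norm (Lfun f s) \<le> real k"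
    unfolding Lfun_def eq using summation_by_parts_antimono[OF norm_partial_sum_le mono lim]
    by (simp_all add: g_def)
qed

text \<open>If L(f, 1) = 0, this gives |L(f, s)| <= C (s - 1), the rate needed to outweigh a pole.
  It comes from partial summation against n^(-1) - n^(-s), whose total variation is O(s -
  1).\<close>

lemma Lfun_lipschitz:
  obtains C where "C > 0" "\<And>s. s > 1 \<Longrightarrow> norm (Lfun f s - Lfun f 1) \<le> C * (s - 1)"
proof
  define V where "V = (\<Sum>n. 3 * real n powr - (3 / 2))"
  have summ: "summable (\<lambda>n. 3 * real n powr - (3 / 2))"
    by (intro summable_mult) (simp add: summable_real_powr_iff)
  have "V \<ge> 0" unfolding V_def by (intro suminf_nonneg summ) auto
  thus "real k * V + 1 > 0" by (simp add: add_nonneg_pos)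
  fix s :: real assume s: "s > 1"
  define g where "g n = real n powr -1 - real n powr -s" for n
  have lim: "g \<longlonglongrightarrow> 0" unfolding g_def using s by real_asymp
  have g_le: "\<bar>g (Suc n) - g n\<bar> \<le> (s - 1) * (3 * real n powr - (3 / 2))" for n
  proof (cases "n = 0")
    case False
    thus ?thesis using inverse_minus_powr_diff_le[OF s, of n] by (simp add: g_def)
  qed (use s in \<open>simp add: g_def\<close>)
  have summ_g: "summable (\<lambda>n. \<bar>g (Suc n) - g n\<bar>)"
    by (rule summable_comparison_test'[OF summable_mult[OF summ, of "s - 1"], of 0]) (use g_le in auto)
  have "Lfun f 1 - Lfun f s = (\<Sum>n. f n * of_real (g n))"
    unfolding Lfun_def g_def using s Lfun_nonprincipal(1)[of 1] Lfun_nonprincipal(1)[of s]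
    by (subst suminf_diff) (simp_all add: algebra_simps)
  hence "norm (Lfun f s - Lfun f 1) = norm (\<Sum>n. f n * of_real (g n))"
    by (metis norm_minus_commute)
  also have "\<dots> \<le> real k * (\<Sum>n. \<bar>g (Suc n) - g n\<bar>)"
    by (rule summation_by_parts_suminf(2)[OF norm_partial_sum_le summ_g lim])
  also have "\<dots> \<le> real k * (\<Sum>n. (s - 1) * (3 * real n powr - (3 / 2)))"
    by (intro mult_left_mono suminf_le g_le summ_g summable_mult summ) auto
  also have "\<dots> = (real k * V) * (s - 1)"
    using suminf_mult[OF summ, of "s - 1"] by (simp add: V_def)
  also have "\<dots> \<le> (real k * V + 1) * (s - 1)" using s by (simp add: algebra_simps)
  finally show "norm (Lfun f s - Lfun f 1) \<le> (real k * V + 1) * (s - 1)" .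
qed

lemma Lfun_tendsto: "(Lfun f \<longlongrightarrow> Lfun f 1) (at_right 1)"
proof -
  obtain C where C: "\<And>s. s > 1 \<Longrightarrow> norm (Lfun f s - Lfun f 1) \<le> C * (s - 1)"
    using Lfun_lipschitz by blast
  have "((\<lambda>s. Lfun f s - Lfun f 1) \<longlongrightarrow> 0) (at_right 1)"
  proof (rule Lim_null_comparison)
    show "\<forall>\<^sub>F s in at_right 1. norm (Lfun f s - Lfun f 1) \<le> C * (s - 1)"
      using C by (auto simp: eventually_at_filter)
    show "((\<lambda>s. C * (s - 1)) \<longlongrightarrow> 0) (at_right 1)"
      by (auto intro!: tendsto_eq_intros)
  qed
  thus ?thesis by (simp add: LIM_zero_iff)
qed

end

section \<open>Quadratic characters\<close>

lemma sum_divisors_coprime_mult: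
  fixes h :: "nat \<Rightarrow> real"
  assumes "coprime a b" "\<And>m n. h (m * n) = h m * h n"
  shows "(\<Sum>d | d dvd a * b. h d) = (\<Sum>d | d dvd a. h d) * (\<Sum>d | d dvd b. h d)"
proof -
  have inj: "inj_on (\<lambda>(d, e). d * e) ({d. d dvd a} \<times> {e. e dvd b})"
  proof (intro inj_onI, clarify)
    fix d e d' e' assume *: "d dvd a" "e dvd b" "d' dvd a" "e' dvd b" "d * e = d' * e'"
    hence "coprime d e'" "coprime d' e"
      using assms(1) coprime_divisors by blast+
    thus "d = d' \<and> e = e'" using * by (simp add: coprime_crossproduct_nat)
  qed
  have image: "(\<lambda>(d, e). d * e) ` ({d. d dvd a} \<times> {e. e dvd b}) = {d. d dvd a * b}"
  proof (intro equalityI subsetI)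
    fix d assume "d \<in> {d. d dvd a * b}"
    then obtain a' b' where "d = a' * b'" "a' dvd a" "b' dvd b"
      using division_decomp by blast
    thus "d \<in> (\<lambda>(d, e). d * e) ` ({d. d dvd a} \<times> {e. e dvd b})" by auto
  qed (auto intro: mult_dvd_mono)
  have "(\<Sum>d | d dvd a * b. h d) = (\<Sum>(d, e)\<in>{d. d dvd a} \<times> {e. e dvd b}. h d * h e)"
    unfolding image[symmetric] by (subst sum.reindex[OF inj]) (simp add: o_def case_prod_unfold assms(2))
  also have "\<dots> = (\<Sum>d | d dvd a. h d) * (\<Sum>d | d dvd b. h d)"
    by (simp add: sum_product sum.cartesian_product)
  finally show ?thesis .
qed

text \<open>Divisor sums are multiplicative, so prime powers decide. There the sum is 1 + h(p) + ...
  + h(p)^k, which is 0 or 1 if h(p) = -1 and has nonnegative terms otherwise.\<close>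

lemma sum_divisors_nonneg:
  fixes h :: "nat \<Rightarrow> real"
  assumes h1: "h (Suc 0) = 1" and mult: "\<And>m n. h (m * n) = h m * h n"
    and vals: "\<And>n. h n \<in> {-1, 0, 1}" and "N > 0"
  shows "(\<Sum>d | d dvd N. h d) \<ge> 0"
  using \<open>N > 0\<close>
proof (induction N rule: less_induct)
  case (less N)
  show ?case
  proof (cases "N = 1")
    case True
    thus ?thesis by (simp add: h1)
  next
    case False
    then obtain p where p: "prime p" "p dvd N" by (metis prime_factor_nat)
    obtain k M where M: "N = p ^ k * M" "\<not> p dvd M"
      using less.prems p by (metis multiplicity_decompose' not_prime_unit neq0_conv)
    have "k > 0" using M p by (cases k) auto
    have "M > 0" using less.prems M by (cases M) auto
    have "M < N"
      using \<open>k > 0\<close> \<open>M > 0\<close> one_less_power[OF prime_gt_1_nat[OF p(1)]] by (simp add: M(1))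
    have h_power: "h (p ^ i) = h p ^ i" for i
      by (induction i) (simp_all add: h1 mult)
    have "{d. d dvd p ^ k} = (\<lambda>i. p ^ i) ` {..k}"
      using divides_primepow_nat[OF p(1)] by auto
    hence "(\<Sum>d | d dvd p ^ k. h d) = (\<Sum>d\<in>(\<lambda>i. p ^ i) ` {..k}. h d)" by simp
    also have "\<dots> = (\<Sum>i\<le>k. h p ^ i)"
      using prime_gt_1_nat[OF p(1)]
      by (subst sum.reindex) (auto simp: inj_on_def h_power o_def)
    also have "\<dots> \<ge> 0"
    proof (cases "h p = -1")
      case True
      have "(\<Sum>i\<le>k. (-1) ^ i) = (if even k then 1 else (0 :: real))"
        by (induction k) auto
      thus ?thesis by (simp add: True)
    next
      case False
      hence "h p \<ge> 0" using vals[of p] by auto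
      thus ?thesis by (intro sum_nonneg) auto
    qed
    finally have "(\<Sum>d | d dvd p ^ k. h d) \<ge> 0" .
    moreover have "(\<Sum>d | d dvd M. h d) \<ge> 0"
      using less.IH \<open>M < N\<close> \<open>M > 0\<close> by blast
    moreover have "coprime (p ^ k) M"
      using p M by (simp add: prime_imp_coprime)
    ultimately show ?thesis
      by (simp add: M(1) sum_divisors_coprime_mult mult)
  qed
qed

text \<open>The absolutely summable family h(n) x^(nk) is summed in two ways: over k first, giving
  the Lambert series, and along nk = N, giving the power series of the divisor sums.\<close>

lemma lambert_series:
  fixes h :: "nat \<Rightarrow> real"
  assumes x: "0 < x" "x < 1" and h: "\<And>n. \<bar>h n\<bar> \<le> 1" "h 0 = 0"
  shows "summable (\<lambda>n. h n * (x ^ n / (1 - x ^ n)))"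
    and "((\<lambda>N. (\<Sum>d | d dvd N. h d) * x ^ N) has_sum (\<Sum>n. h n * (x ^ n / (1 - x ^ n)))) {1..}"
proof -
  define G where "G = (\<lambda>(n::nat, k::nat). h n * x ^ (n * k))"
  have row: "((\<lambda>k. x ^ (n * k)) has_sum (x ^ n / (1 - x ^ n))) {1..}" if "n \<in> {1..}" for n :: nat
    using has_sum_geometric_from_1[of "x ^ n"] x that by (simp add: power_mult power_less_one_iff)
  have "(\<lambda>n. x ^ n / (1 - x ^ n)) summable_on {1..}"
  proof (rule summable_on_comparison_test)
    show "(\<lambda>n. x ^ n * (1 / (1 - x))) summable_on {1..}"
      using has_sum_geometric_from_1[of x] x by (intro summable_on_cmult_left) (auto simp: summable_on_def)
    fix n :: nat assume n: "n \<in> {1..}"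
    hence "x ^ n \<le> x ^ 1" using x by (intro power_decreasing) auto
    thus "x ^ n / (1 - x ^ n) \<le> x ^ n * (1 / (1 - x))"
      using x by (simp add: divide_left_mono frac_le)
    show "0 \<le> x ^ n / (1 - x ^ n)" using x by (simp add: power_le_one)
  qed
  hence "(\<lambda>(n, k). x ^ (n * k)) summable_on {1..} \<times> {1..}"
    by (intro summable_on_SigmaI[where g = "\<lambda>n. x ^ n / (1 - x ^ n)"]) (use row x in auto)
  hence "(\<lambda>z. norm (G z)) summable_on {1..} \<times> {1..}"
    by (rule summable_on_comparison_test)
       (use h x in \<open>auto simp: G_def abs_mult intro!: mult_left_le_one_le\<close>)
  hence "G summable_on {1..} \<times> {1..}" by (rule abs_summable_summable)
  then obtain S where S: "(G has_sum S) ({1..} \<times> {1..})"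
    by (auto simp: summable_on_def)
  have "((\<lambda>n. h n * (x ^ n / (1 - x ^ n))) has_sum S) {1..}"
  proof (rule has_sum_SigmaD[OF S])
    show "((\<lambda>k. G (n, k)) has_sum h n * (x ^ n / (1 - x ^ n))) {1..}" if "n \<in> {1..}" for n
      unfolding G_def prod.case by (intro has_sum_cmult_right row that)
  qed
  hence "((\<lambda>n. h n * (x ^ n / (1 - x ^ n))) has_sum S) UNIV"
    by (rule has_sum_cong_neutral[THEN iffD1, rotated -1]) (auto simp: h not_le)
  hence sums: "(\<lambda>n. h n * (x ^ n / (1 - x ^ n))) sums S"
    by (rule has_sum_imp_sums)
  thus "summable (\<lambda>n. h n * (x ^ n / (1 - x ^ n)))" by (rule sums_summable)
  \<comment> \<open>The pair (n, k) corresponds to N = nk together with its divisor d = n.\<close>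
  have "(G has_sum S) ({1..} \<times> {1..}) =
      ((\<lambda>(N, d). h d * x ^ N) has_sum S) (SIGMA N:{1..}. {d. d dvd N})"
    by (rule has_sum_reindex_bij_witness[where i = "\<lambda>(N, d). (d, N div d)" and j = "\<lambda>(n, k). (n * k, n)"])
       (auto simp: G_def Suc_le_eq intro!: Nat.gr0I elim!: dvdE)
  with S have "((\<lambda>(N, d). h d * x ^ N) has_sum S) (SIGMA N:{1..}. {d. d dvd N})" by simp
  hence "((\<lambda>N. (\<Sum>d | d dvd N. h d) * x ^ N) has_sum S) {1..}"
    by (rule has_sum_SigmaD) (auto simp: sum_distrib_right intro!: has_sum_finiteI)
  thus "((\<lambda>N. (\<Sum>d | d dvd N. h d) * x ^ N) has_sum (\<Sum>n. h n * (x ^ n / (1 - x ^ n)))) {1..}"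
    using sums by (simp add: sums_iff)
qed

text \<open>Pair the exponents i and n - 1 - i and apply the inequality of the two means. Working
  with y^2 avoids half-integral exponents of x = y^2.\<close>

lemma geometric_sum_ge:
  fixes y :: real
  assumes "0 \<le> y"
  shows "real n * y ^ (n - 1) \<le> (\<Sum>i<n. (y\<^sup>2) ^ i)"
proof -
  have "2 * (\<Sum>i<n. (y\<^sup>2) ^ i) = (\<Sum>i<n. (y\<^sup>2) ^ i) + (\<Sum>i<n. (y\<^sup>2) ^ (n - Suc i))"
    by (simp add: sum.nat_diff_reindex)
  also have "\<dots> = (\<Sum>i<n. (y ^ i)\<^sup>2 + (y ^ (n - Suc i))\<^sup>2)"
    by (simp add: sum.distrib flip: power_mult) (simp add: mult.commute)
  also have "\<dots> \<ge> (\<Sum>i<n. 2 * y ^ (n - 1))"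
  proof (rule sum_mono)
    fix i assume "i \<in> {..<n}"
    hence "y ^ (n - 1) = y ^ i * y ^ (n - Suc i)" by (simp flip: power_add)
    thus "2 * y ^ (n - 1) \<le> (y ^ i)\<^sup>2 + (y ^ (n - Suc i))\<^sup>2"
      using sum_squares_bound[of "y ^ i" "y ^ (n - Suc i)"] by simp
  qed
  finally show ?thesis by simp
qed

text \<open>With A and B the geometric sums of lengths n and n + 1, the claim reduces to n (n+1) x^n
  <= A B. The bounds A >= n x^((n-1)/2) and B >= (n+1) x^(n/2) give this, even with half a power of
  x to spare.\<close>

lemma lambert_difference_antimono:
  fixes x :: real
  assumes x: "0 < x" "x < 1" and n: "n \<ge> 1"
  shows "1 / (real (Suc n) * (1 - x)) - x ^ Suc n / (1 - x ^ Suc n)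
       \<le> 1 / (real n * (1 - x)) - x ^ n / (1 - x ^ n)"
proof -
  define y where "y = sqrt x"
  have y: "0 < y" "y < 1" "y\<^sup>2 = x" using x by (auto simp: y_def)
  define A where "A = (\<Sum>i<n. x ^ i)"
  define B where "B = (\<Sum>i<Suc n. x ^ i)"
  have A: "1 - x ^ n = (1 - x) * A" and B: "1 - x ^ Suc n = (1 - x) * B"
    unfolding A_def B_def using one_diff_power_eq[of x] by blast+
  have AB_ge: "A \<ge> real n * y ^ (n - 1)" "B \<ge> real (Suc n) * y ^ n"
    using geometric_sum_ge[of y n] geometric_sum_ge[of y "Suc n"] y by (auto simp: A_def B_def)
  have pos: "A > 0" "B > 0"
    using AB_ge y n by (auto intro: less_le_trans[rotated])
  have "real n * real (Suc n) * x ^ n = (real n * y ^ n) * (real (Suc n) * y ^ n)"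
    by (simp flip: y(3) power_mult add: power_mult_distrib power2_eq_square power_mult mult_ac)
  also have "\<dots> \<le> (real n * y ^ (n - 1)) * (real (Suc n) * y ^ n)"
    using y by (intro mult_right_mono mult_left_mono power_decreasing) auto
  also have "\<dots> \<le> A * B"
    using AB_ge y pos by (intro mult_mono) auto
  finally have key: "real n * real (Suc n) * x ^ n \<le> A * B" .
  have "x ^ n / (1 - x ^ n) - x ^ Suc n / (1 - x ^ Suc n) = x ^ n * (1 - x) / ((1 - x ^ n) * (1 - x ^ Suc n))"
  proof -
    have "1 - x ^ n \<noteq> 0" "1 - x ^ Suc n \<noteq> 0" using A B pos x by auto
    thus ?thesis by (simp add: diff_frac_eq) (simp add: algebra_simps)
  qed
  also have "\<dots> = x ^ n / ((1 - x) * (A * B))"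
    unfolding A B using x by simp
  also have "\<dots> \<le> 1 / ((1 - x) * (real n * real (Suc n)))"
  proof -
    have "x ^ n / (A * B) \<le> 1 / (real n * real (Suc n))"
      using key pos n
      by (simp add: pos_divide_le_eq pos_le_divide_eq mult_ac del: of_nat_Suc)
    hence "x ^ n / (A * B) / (1 - x) \<le> 1 / (real n * real (Suc n)) / (1 - x)"
      using x by (intro divide_right_mono) auto
    thus ?thesis by (simp add: mult.commute)
  qed
  also have "\<dots> = 1 / (real n * real (Suc n)) / (1 - x)"
    by (simp add: mult.commute)
  also have "1 / (real n * real (Suc n)) = 1 / real n - 1 / real (Suc n)"
    using n by (simp add: field_simps)
  also have "(1 / real n - 1 / real (Suc n)) / (1 - x) = 1 / (real n * (1 - x)) - 1 / (real (Suc n) * (1 - x))"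
    by (simp add: diff_divide_distrib)
  finally show ?thesis by linarith
qed

context periodic_zero_sum
begin

text \<open>If L(f, 1) = 0, the Lambert series S is bounded by k on (0, 1), by partial summation.
  But S is a power series with nonnegative coefficients that equal 1 at every power of k, so its k +
  1 terms at 1, k, ..., k^k already tend to k + 1 as x tends to 1.\<close>

lemma Lfun_real_nonzero:
  assumes vals: "\<And>n. f n \<in> {-1, 0, 1}" and k: "prime k"
  shows "Lfun f 1 \<noteq> 0"
proof
  assume L0: "Lfun f 1 = 0"
  define h where "h n = Re (f n)" for n
  have fh: "f n = of_real (h n)" for n using vals[of n] by (auto simp: h_def)
  have h_vals: "h n \<in> {-1, 0, 1}" for n using vals[of n] by (auto simp: h_def)
  have h_mult: "h (m * n) = h m * h n" for m n
    using f_mult[of m n] unfolding fh by (metis of_real_eq_iff of_real_mult)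
  have h_1: "h (Suc 0) = 1" and h_0: "h 0 = 0" by (simp_all add: h_def f_1 f_0)
  have h_k: "h k = 0" using f_periodic[of 0] by (simp add: h_def f_0)
  have h_abs: "\<bar>h n\<bar> \<le> 1" for n using h_vals[of n] by auto
  have bound: "(\<Sum>i<Suc k. x ^ (k ^ i)) \<le> real k" if x: "0 < x" "x < 1" for x :: real
  proof -
    define S where "S = (\<Sum>n. h n * (x ^ n / (1 - x ^ n)))"
    note lambert = lambert_series[of x h, OF x h_abs h_0]
    have c_nonneg: "(\<Sum>d | d dvd N. h d) \<ge> 0" if "N > 0" for N
      by (rule sum_divisors_nonneg) (use h_1 h_mult h_vals that in auto)
    \<comment> \<open>Since k is prime, every divisor of k^i except 1 is a multiple of k, where h
      vanishes.\<close>
    have c_k: "(\<Sum>d | d dvd k ^ i. h d) = 1" for i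
    proof -
      have "(\<Sum>d | d dvd k ^ i. h d) = (\<Sum>d\<in>{1}. h d)"
      proof (rule sum.mono_neutral_right)
        show "\<forall>d\<in>{d. d dvd k ^ i} - {1}. h d = 0"
        proof
          fix d assume "d \<in> {d. d dvd k ^ i} - {1}"
          then obtain j where "d = k ^ j" "j \<noteq> 0"
            using divides_primepow_nat[OF k] by force
          thus "h d = 0" by (cases j) (auto simp: h_mult h_k)
        qed
      qed (use k in \<open>auto simp: prime_gt_0_nat\<close>)
      thus ?thesis by (simp add: h_1)
    qed
    have inj: "inj_on (\<lambda>i. k ^ i) {..<Suc k}"
      using prime_gt_1_nat[OF k] by (auto simp: inj_on_def)
    have "(\<Sum>i<Suc k. x ^ (k ^ i)) = (\<Sum>N\<in>(\<lambda>i. k ^ i) ` {..<Suc k}. (\<Sum>d | d dvd N. h d) * x ^ N)"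
      by (subst sum.reindex[OF inj]) (simp add: c_k o_def)
    also have "\<dots> \<le> S"
      unfolding S_def
      by (rule finite_sum_le_has_sum[OF lambert(2)])
         (use k c_nonneg x in \<open>auto simp: Suc_le_eq prime_gt_0_nat\<close>)
    also have "S \<le> real k"
    proof -
      \<comment> \<open>\<open>max 1 n\<close> repeats the value at 1 for index 0, which keeps g
        decreasing. The term itself is killed by f(0) = 0, and g(0) = 1/(1-x) - x/(1-x) = 1.\<close>
      define g where "g n = (let n = max 1 n in 1 / (real n * (1 - x)) - x ^ n / (1 - x ^ n))" for n :: nat
      have g_Suc: "g (Suc n) \<le> g n" for n
      proof (cases "n = 0")
        case False
        thus ?thesis using lambert_difference_antimono[OF x, of n] by (simp add: g_def max_def)
      qed (simp add: g_def)
      have g_0: "g 0 = 1"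
        using x by (simp add: g_def flip: diff_divide_distrib)
      have "(\<lambda>n. 1 / (real n * (1 - x)) - x ^ n / (1 - x ^ n)) \<longlonglongrightarrow> 0"
      proof -
        have "(\<lambda>n. 1 / (real n * (1 - x))) \<longlonglongrightarrow> 0" using x by real_asymp
        moreover have "(\<lambda>n. x ^ n / (1 - x ^ n)) \<longlonglongrightarrow> 0 / (1 - 0)"
          using x by (intro tendsto_intros LIMSEQ_power_zero) auto
        ultimately show ?thesis using tendsto_diff by fastforce
      qed
      hence lim: "g \<longlonglongrightarrow> 0"
        by (rule Lim_transform_eventually)
           (auto simp: g_def max_def intro!: eventually_sequentiallyI[of 1])
      have "norm (\<Sum>n. f n * of_real (g n)) \<le> real k * g 0"
        by (rule summation_by_parts_antimono(2)[OF norm_partial_sum_le g_Suc lim])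
      \<comment> \<open>This is where L(f, 1) = 0 enters: 1/(1-x) times the series for L(f, 1) can
        be added to -S without changing the sum.\<close>
      moreover have "(\<lambda>n. f n * of_real (g n)) sums (- of_real S)"
      proof -
        have "(\<lambda>n. f n * of_real (real n powr -1)) sums 0"
          using Lfun_nonprincipal(1)[of 1] L0 by (simp add: Lfun_def sums_iff)
        hence "(\<lambda>n. f n * of_real (real n powr -1) * of_real (1 / (1 - x))) sums (0 * of_real (1 / (1 - x)))"
          by (rule sums_mult2)
        moreover have "(\<lambda>n. of_real (h n * (x ^ n / (1 - x ^ n))) :: complex) sums of_real S"
          using lambert(1) unfolding S_def by (intro sums_of_real summable_sums)
        ultimately have "(\<lambda>n. f n * of_real (real n powr -1) * of_real (1 / (1 - x)) -
             of_real (h n * (x ^ n / (1 - x ^ n)))) sums (0 * of_real (1 / (1 - x)) - of_real S)"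
          by (rule sums_diff)
        moreover have "f n * of_real (real n powr -1) * of_real (1 / (1 - x)) -
             of_real (h n * (x ^ n / (1 - x ^ n))) = f n * of_real (g n)" for n
        proof (cases "n = 0")
          case False
          thus ?thesis
            by (simp add: g_def max_def fh powr_minus_divide flip: of_real_mult of_real_diff)
               (simp add: algebra_simps)
        qed (simp add: h_0 f_0)
        ultimately show ?thesis by simp
      qed
      ultimately have "\<bar>S\<bar> \<le> real k" by (simp add: sums_iff g_0)
      thus ?thesis by simp
    qed
    finally show ?thesis .
  qed
  have "((\<lambda>x. \<Sum>i<Suc k. x ^ (k ^ i)) \<longlongrightarrow> (\<Sum>i<Suc k. 1 ^ (k ^ i))) (at_left (1::real))"
    by (intro tendsto_intros)
  hence "(\<Sum>i<Suc k. 1 ^ (k ^ i)) \<le> real k"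
    by (rule tendsto_upperbound)
       (use bound in \<open>auto intro!: eventually_at_leftI[of 0] simp del: sum.lessThan_Suc\<close>)
  thus False by simp
qed

end

section \<open>Characters modulo a prime\<close>

definition unit_root :: "nat \<Rightarrow> nat \<Rightarrow> complex" where
  "unit_root N m = exp (2 * of_real pi * \<i> * of_nat m / of_nat N)"

lemma unit_root_add: "unit_root N (a + b) = unit_root N a * unit_root N b"
  by (simp add: unit_root_def algebra_simps add_divide_distrib flip: exp_add)

lemma unit_root_eq_iff: "N > 0 \<Longrightarrow> unit_root N a = unit_root N b \<longleftrightarrow> [a = b] (mod N)"
  unfolding unit_root_def cong_def by (rule complex_root_unity_eq) simp

lemma unit_root_0 [simp]: "unit_root N 0 = 1"
  by (simp add: unit_root_def)

lemma unit_root_eq_1_iff: "N > 0 \<Longrightarrow> unit_root N a = 1 \<longleftrightarrow> N dvd a"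
  using unit_root_eq_iff[of N a 0] by (simp add: cong_0_iff)

lemma unit_root_mult: "unit_root N (a * b) = unit_root N b ^ a"
  by (induction a) (simp_all add: unit_root_add)

lemma norm_unit_root [simp]: "norm (unit_root N a) = 1"
proof -
  have "unit_root N a = exp (\<i> * of_real (2 * pi * real a / real N))"
    by (simp add: unit_root_def mult_ac)
  thus ?thesis by (simp only: norm_exp_i_times)
qed

lemma cnj_unit_root:
  assumes "N dvd a + b" "N > 0"
  shows "unit_root N a = cnj (unit_root N b)"
proof -
  have "unit_root N a * unit_root N b = 1"
    using assms by (simp add: unit_root_eq_1_iff flip: unit_root_add)
  moreover have "unit_root N b * cnj (unit_root N b) = 1"
    using complex_norm_square[of "unit_root N b"] by simp
  ultimately show ?thesis
    by (metis mult.assoc mult.commute mult.right_neutral)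
qed

section \<open>Discrete logarithms and the characters of a prime modulus\<close>

definition primroot :: "nat \<Rightarrow> nat" where
  "primroot q = (SOME g. residue_primroot q g)"

text \<open>For n prime to q, the choice matters only modulo q - 1, which is all that
  \<open>unit_root (q - 1)\<close> sees. Multiples of q have no logarithm and are excluded in
  \<open>dchar\<close>.\<close>

definition dlog :: "nat \<Rightarrow> nat \<Rightarrow> nat" where
  "dlog q n = (SOME i. [primroot q ^ i = n] (mod q))"

text \<open>For prime q the indices j < q - 1 enumerate all Dirichlet characters modulo q, with j =
  0 the principal one.\<close>

definition dchar :: "nat \<Rightarrow> nat \<Rightarrow> nat \<Rightarrow> complex" where
  "dchar q j n = (if q dvd n then 0 else unit_root (q - 1) (j * dlog q n))"

context
  fixes q :: nat
  assumes q: "prime q"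
begin

lemma q_gt_1: "q > 1"
  using q prime_gt_1_nat by blast

lemma residue_primroot_primroot: "residue_primroot q (primroot q)"
  unfolding primroot_def using prime_primitive_root_exists[of q] q q_gt_1 by (metis someI_ex)

lemma coprime_primroot: "coprime q (primroot q)"
  and ord_primroot: "ord q (primroot q) = q - 1"
  using residue_primroot_primroot q by (auto simp: residue_primroot_def totient_prime)

lemma dlog:
  assumes "\<not> q dvd n"
  shows "[primroot q ^ dlog q n = n] (mod q)"
proof -
  have "n mod q \<in> totatives q"
    using prime_imp_coprime[OF q assms] assms q_gt_1
    by (auto simp: totatives_def coprime_commute mod_greater_zero_iff_not_dvd less_imp_le)
  hence "n mod q \<in> (\<lambda>i. primroot q ^ i mod q) ` {..<totient q}"
    using residue_primroot_is_generator[OF q_gt_1 residue_primroot_primroot]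
    by (simp add: bij_betw_def)
  then obtain i where "[primroot q ^ i = n] (mod q)"
    by (auto simp: cong_def)
  thus ?thesis unfolding dlog_def by (rule someI)
qed

lemma primroot_power_cong_iff: "[primroot q ^ a = primroot q ^ b] (mod q) \<longleftrightarrow> [a = b] (mod (q - 1))"
  using order_divides_expdiff[OF coprime_primroot] by (simp add: ord_primroot)

lemma dlog_cong:
  assumes "[m = n] (mod q)" "\<not> q dvd m"
  shows "[dlog q m = dlog q n] (mod (q - 1))"
proof -
  have "\<not> q dvd n" using assms by (simp add: cong_dvd_iff)
  hence "[primroot q ^ dlog q m = primroot q ^ dlog q n] (mod q)"
    using assms dlog by (meson cong_sym cong_trans)
  thus ?thesis by (simp add: primroot_power_cong_iff)
qed

lemma dlog_mult:
  assumes "\<not> q dvd m" "\<not> q dvd n"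
  shows "[dlog q (m * n) = dlog q m + dlog q n] (mod (q - 1))"
proof -
  have "\<not> q dvd m * n" using assms q by (simp add: prime_dvd_mult_iff)
  have "[primroot q ^ (dlog q m + dlog q n) = m * n] (mod q)"
    unfolding power_add using assms by (intro cong_mult dlog)
  hence "[primroot q ^ dlog q (m * n) = primroot q ^ (dlog q m + dlog q n)] (mod q)"
    using dlog[OF \<open>\<not> q dvd m * n\<close>] by (meson cong_sym cong_trans)
  thus ?thesis by (simp add: primroot_power_cong_iff)
qed

lemma unit_root_cong_mult:
  assumes "[a = b] (mod (q - 1))"
  shows "unit_root (q - 1) (j * a) = unit_root (q - 1) (j * b)"
  using assms q_gt_1 by (subst unit_root_eq_iff) (auto intro: cong_mult)

lemma dchar_cong:
  assumes "[m = n] (mod q)"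
  shows "dchar q j m = dchar q j n"
proof (cases "q dvd m")
  case True
  thus ?thesis using assms by (simp add: dchar_def cong_dvd_iff)
next
  case False
  thus ?thesis
    using assms unit_root_cong_mult[OF dlog_cong[OF assms]] by (auto simp: dchar_def cong_dvd_iff)
qed

lemma dchar_cong_1:
  assumes "[n = 1] (mod q)"
  shows "dchar q j n = 1"
proof -
  have not_dvd: "\<not> q dvd n" using assms q_gt_1 by (auto simp: cong_dvd_iff)
  have "[primroot q ^ dlog q n = primroot q ^ 0] (mod q)"
    using dlog[OF not_dvd] assms by (auto intro: cong_trans)
  hence "[dlog q n = 0] (mod (q - 1))" by (simp only: primroot_power_cong_iff)
  thus ?thesis
    using not_dvd unit_root_cong_mult[of "dlog q n" 0 j] by (simp add: dchar_def)
qed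

lemma dchar_mult: "dchar q j (m * n) = dchar q j m * dchar q j n"
proof (cases "q dvd m \<or> q dvd n")
  case False
  thus ?thesis
    using unit_root_cong_mult[OF dlog_mult[of m n], of j] q
    by (auto simp: dchar_def prime_dvd_mult_iff unit_root_add algebra_simps)
qed (auto simp: dchar_def)

lemma norm_dchar_le: "norm (dchar q j n) \<le> 1"
  by (simp add: dchar_def)

lemma mult_bounded_dchar: "mult_bounded (dchar q j)"
  by standard (simp_all add: dchar_cong_1 dchar_mult norm_dchar_le)

lemma dchar_primroot:
  assumes "0 < j" "j < q - 1"
  shows "dchar q j (primroot q) \<noteq> 1"
proof -
  have not_dvd: "\<not> q dvd primroot q"
    using coprime_primroot q_gt_1 by (auto simp: coprime_absorb_left)
  have "[primroot q ^ dlog q (primroot q) = primroot q ^ 1] (mod q)"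
    using dlog[OF not_dvd] by simp
  hence "[dlog q (primroot q) = 1] (mod (q - 1))" by (simp only: primroot_power_cong_iff)
  hence "dchar q j (primroot q) = unit_root (q - 1) j"
    using not_dvd unit_root_cong_mult[of "dlog q (primroot q)" 1 j] by (simp add: dchar_def)
  moreover have "\<not> q - 1 dvd j" using assms by (auto dest: dvd_imp_le)
  ultimately show ?thesis using unit_root_eq_1_iff[of "q - 1" j] q_gt_1 by simp
qed

text \<open>Orthogonality: for n prime to q the sum over j is geometric with ratio w satisfying
  w^(q-1) = 1, and w = 1 only when n is 1 modulo q.\<close>

lemma sum_dchar: "(\<Sum>j<q - 1. dchar q j n) = (if [n = 1] (mod q) then of_nat (q - 1) else 0)"
proof (cases "q dvd n")
  case True
  hence "\<not> [n = 1] (mod q)" using q_gt_1 by (auto simp: cong_dvd_iff)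
  thus ?thesis using True by (simp add: dchar_def)
next
  case False
  show ?thesis
  proof (cases "[n = 1] (mod q)")
    case True
    thus ?thesis by (simp add: dchar_cong_1)
  next
    case n: False
    define w where "w = unit_root (q - 1) (dlog q n)"
    have "\<not> [primroot q ^ dlog q n = primroot q ^ 0] (mod q)"
      using n dlog[OF False] by (auto dest: cong_sym cong_trans)
    hence "\<not> [dlog q n = 0] (mod (q - 1))" by (simp only: primroot_power_cong_iff not_False_eq_True)
    hence "w \<noteq> 1" unfolding w_def using q_gt_1 by (simp add: unit_root_eq_1_iff cong_0_iff)
    moreover have "w ^ (q - 1) = 1"
      unfolding w_def unit_root_mult[symmetric] using q_gt_1 by (subst unit_root_eq_1_iff) auto
    ultimately have "(\<Sum>j<q - 1. w ^ j) = 0" by (simp add: geometric_sum)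
    thus ?thesis using n False by (simp add: dchar_def unit_root_mult w_def)
  qed
qed

lemma dchar_diff:
  assumes "j \<le> q - 1"
  shows "dchar q (q - 1 - j) n = cnj (dchar q j n)"
proof (cases "q dvd n")
  case False
  have "(q - 1 - j) * dlog q n + j * dlog q n = (q - 1) * dlog q n"
    using assms by (metis add_mult_distrib le_add_diff_inverse2)
  hence "q - 1 dvd (q - 1 - j) * dlog q n + j * dlog q n"
    by simp
  thus ?thesis using False q_gt_1 by (simp add: dchar_def cnj_unit_root)
qed (simp add: dchar_def)

lemma dchar_half:
  assumes "2 * j = q - 1"
  shows "dchar q j n \<in> {-1, 0, 1}"
proof (cases "q dvd n")
  case False
  have "(unit_root (q - 1) (j * dlog q n))\<^sup>2 = unit_root (q - 1) (2 * (j * dlog q n))"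
    by (simp only: unit_root_mult)
  also have "2 * (j * dlog q n) = (q - 1) * dlog q n" using assms by simp
  also have "unit_root (q - 1) \<dots> = 1" using q_gt_1 by (subst unit_root_eq_1_iff) auto
  finally show ?thesis using False by (auto simp: dchar_def power2_eq_1_iff)
qed (simp add: dchar_def)

end

text \<open>Multiplication by a permutes the residues, so the sum S over a period satisfies S = f(a)
  S.\<close>

lemma sum_period_eq_0:
  fixes f :: "nat \<Rightarrow> complex"
  assumes mult: "\<And>m n. f (m * n) = f m * f n" and per: "\<And>m n. [m = n] (mod k) \<Longrightarrow> f m = f n"
    and a: "coprime a k" "f a \<noteq> 1" and "k > 0"
  shows "(\<Sum>n<k. f n) = 0"
proof -
  have inj: "inj_on (\<lambda>n. a * n mod k) {..<k}"
  proof (rule inj_onI)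
    fix m n assume "m \<in> {..<k}" "n \<in> {..<k}" "a * m mod k = a * n mod k"
    hence "[m = n] (mod k)" using a(1) cong_mult_lcancel_nat[of a k m n] by (simp add: cong_def)
    thus "m = n" using \<open>m \<in> {..<k}\<close> \<open>n \<in> {..<k}\<close> by (simp add: cong_def)
  qed
  have "(\<lambda>n. a * n mod k) ` {..<k} = {..<k}"
    using \<open>k > 0\<close> by (intro endo_inj_surj inj) auto
  hence "(\<Sum>n<k. f n) = (\<Sum>n\<in>(\<lambda>n. a * n mod k) ` {..<k}. f n)" by simp
  also have "\<dots> = (\<Sum>n<k. f (a * n))"
    by (subst sum.reindex[OF inj]) (auto intro!: sum.cong per simp: cong_def)
  also have "\<dots> = f a * (\<Sum>n<k. f n)" by (simp add: mult sum_distrib_left)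
  finally show ?thesis using a(2) by (simp add: mult_cancel_right1)
qed

section \<open>Primes congruent to 1 modulo q but not modulo p\<close>

lemma periodic_zero_sum_dchar:
  assumes q: "prime q" and "0 < j" "j < q - 1"
  shows "periodic_zero_sum (dchar q j) q"
proof -
  interpret mult_bounded "dchar q j" by (rule mult_bounded_dchar[OF q])
  show ?thesis
  proof
    show "q > 0" using q by (rule prime_gt_0_nat)
    show "dchar q j 0 = 0" by (simp add: dchar_def)
    show "dchar q j (n + q) = dchar q j n" for n
      by (rule dchar_cong[OF q]) (simp add: cong_def)
    show "(\<Sum>n<q. dchar q j n) = 0"
      using coprime_primroot[OF q] dchar_primroot[OF q assms(2,3)] dchar_cong[OF q] dchar_mult[OF q] prime_gt_0_nat[OF q]
      by (intro sum_period_eq_0[where a = "primroot q"]) (auto simp: coprime_commute)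
  qed
qed

lemma periodic_zero_sum_dchar_mult:
  assumes p: "prime p" and q: "prime q" and "p \<noteq> q" "0 < i" "i < p - 1"
  shows "periodic_zero_sum (\<lambda>n. dchar q j n * dchar p i n) (p * q)"
proof
  show "dchar q j (Suc 0) * dchar p i (Suc 0) = 1"
    using dchar_cong_1[OF p, of "Suc 0"] dchar_cong_1[OF q, of "Suc 0"] by simp
  show mult: "dchar q j (m * n) * dchar p i (m * n) = dchar q j m * dchar p i m * (dchar q j n * dchar p i n)" for m n
    by (simp add: dchar_mult p q)
  show "norm (dchar q j n * dchar p i n) \<le> 1" for n
    using norm_dchar_le[OF p, of i n] norm_dchar_le[OF q, of j n] by (simp add: norm_mult mult_le_one)
  show "p * q > 0" using p q by (simp add: prime_gt_0_nat)
  show "dchar q j 0 * dchar p i 0 = 0" by (simp add: dchar_def)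
  have cong: "dchar q j m * dchar p i m = dchar q j n * dchar p i n" if "[m = n] (mod (p * q))" for m n
    using that dchar_cong[OF p, of m n i] dchar_cong[OF q, of m n j]
    by (metis cong_modulus_mult_nat mult.commute)
  show "dchar q j (n + p * q) * dchar p i (n + p * q) = dchar q j n * dchar p i n" for n
    by (rule cong) (simp add: cong_def)
  have "coprime p q" using assms by (simp add: primes_coprime)
  \<comment> \<open>At this residue the character modulo q is 1 and the one modulo p is not, so the
    product is nonprincipal for every j, including j = 0.\<close>
  then obtain a where a: "[a = primroot p] (mod p)" "[a = 1] (mod q)"
    using binary_chinese_remainder_nat by blast
  have "coprime a p"
    using coprime_primroot[OF p] a(1) by (metis cong_imp_coprime cong_sym coprime_commute)
  moreover have "coprime a q"
    using a(2) by (metis cong_imp_coprime cong_sym coprime_1_left)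
  ultimately have "coprime a (p * q)" by simp
  moreover have "dchar q j a * dchar p i a \<noteq> 1"
    using a dchar_cong_1[OF q a(2)] dchar_cong[OF p a(1)] dchar_primroot[OF p assms(4,5)] by simp
  ultimately show "(\<Sum>n<p * q. dchar q j n * dchar p i n) = 0"
    using mult cong \<open>p * q > 0\<close> by (intro sum_period_eq_0[where a = a])
qed

section \<open>Products of L-series over all characters modulo q\<close>

lemma sum_prime_sum:
  assumes "\<And>j. j \<in> A \<Longrightarrow> mult_bounded (F j)" "s > 1" "finite A"
  shows "(\<Sum>j\<in>A. prime_sum (F j) s) =
         (\<Sum>n. if prime n then (\<Sum>j\<in>A. F j n) * of_real (real n powr -s) else 0)"
proof -
  have "(\<Sum>j\<in>A. prime_sum (F j) s) =
      (\<Sum>n. \<Sum>j\<in>A. if prime n then F j n * of_real (real n powr -s) else 0)"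
    unfolding prime_sum_def
    using mult_bounded.summable_restrict[OF assms(1,2)] by (intro suminf_sum [symmetric])
  also have "(\<lambda>n. \<Sum>j\<in>A. if prime n then F j n * of_real (real n powr -s) else 0) =
      (\<lambda>n. if prime n then (\<Sum>j\<in>A. F j n) * of_real (real n powr -s) else 0)"
    by (auto simp: sum_distrib_right)
  finally show ?thesis .
qed

lemma prod_Lfun_bounds:
  assumes "\<And>j. j \<in> A \<Longrightarrow> mult_bounded (F j)" "s > 1" "finite A"
  defines "R \<equiv> Re (\<Sum>j\<in>A. prime_sum (F j) s)"
  shows "exp (R - 2 * card A) \<le> (\<Prod>j\<in>A. norm (Lfun (F j) s))"
    and "(\<Prod>j\<in>A. norm (Lfun (F j) s)) \<le> exp (R + 2 * card A)"
proof -
  have "exp (R - 2 * card A) = (\<Prod>j\<in>A. exp (Re (prime_sum (F j) s) - 2))"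
    using assms(3) by (simp add: R_def sum_subtractf flip: exp_sum)
  also have "\<dots> \<le> (\<Prod>j\<in>A. norm (Lfun (F j) s))"
    using mult_bounded.Lfun_bounds(1)[OF assms(1,2)] by (intro prod_mono) auto
  finally show "exp (R - 2 * card A) \<le> (\<Prod>j\<in>A. norm (Lfun (F j) s))" .
  have "(\<Prod>j\<in>A. norm (Lfun (F j) s)) \<le> (\<Prod>j\<in>A. exp (Re (prime_sum (F j) s) + 2))"
    using mult_bounded.Lfun_bounds(2)[OF assms(1,2)] by (intro prod_mono) auto
  also have "\<dots> = exp (R + 2 * card A)"
    using assms(3) by (simp add: R_def sum.distrib flip: exp_sum)
  finally show "(\<Prod>j\<in>A. norm (Lfun (F j) s)) \<le> exp (R + 2 * card A)" .
qed

text \<open>By orthogonality the prime sums add up to q - 1 times the sum of n^(-s) over primes n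
  congruent to 1 modulo q, which is nonnegative. The lower bound is independent of s and excludes
  two zeros at 1 against a single pole.\<close>

lemma prod_Lfun_dchar_ge:
  assumes q: "prime q" and s: "s > 1"
  shows "exp (- 2 * real (q - 1)) \<le> (\<Prod>j<q - 1. norm (Lfun (dchar q j) s))"
proof -
  define t where "t n = (if prime n then (if [n = 1] (mod q) then real (q - 1) else 0) * real n powr -s else 0)" for n
  have "summable t"
  proof (rule summable_comparison_test')
    show "summable (\<lambda>n. real (q - 1) * real n powr -s)"
      using s by (intro summable_mult) (simp add: summable_real_powr_iff)
    show "norm (t n) \<le> real (q - 1) * real n powr -s" for n
      by (simp add: t_def abs_mult)
  qed
  have "(\<Sum>j<q - 1. prime_sum (dchar q j) s) =
      (\<Sum>n. if prime n then (\<Sum>j<q - 1. dchar q j n) * of_real (real n powr -s) else 0)"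
    by (rule sum_prime_sum) (use s mult_bounded_dchar[OF q] in auto)
  also have "\<dots> = (\<Sum>n. of_real (t n))"
    unfolding sum_dchar[OF q] by (intro arg_cong[where f = suminf]) (auto simp: t_def)
  also have "\<dots> = of_real (\<Sum>n. t n)"
    using \<open>summable t\<close> by (rule suminf_of_real [symmetric])
  finally have "Re (\<Sum>j<q - 1. prime_sum (dchar q j) s) = (\<Sum>n. t n)" by simp
  moreover have "(\<Sum>n. t n) \<ge> 0"
    by (rule suminf_nonneg[OF \<open>summable t\<close>]) (simp add: t_def)
  ultimately have "exp (- 2 * real (q - 1)) \<le>
      exp (Re (\<Sum>j<q - 1. prime_sum (dchar q j) s) - real (2 * card {..<q - 1}))"
    by simp
  also have "\<dots> \<le> (\<Prod>j<q - 1. norm (Lfun (dchar q j) s))"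
    by (rule prod_Lfun_bounds(1)) (use mult_bounded_dchar[OF q] s in auto)
  finally show ?thesis .
qed

lemma norm_Lfun_dchar_diff:
  assumes q: "prime q" and "j \<le> q - 1" "s > 1"
  shows "norm (Lfun (dchar q (q - 1 - j)) s) = norm (Lfun (dchar q j) s)"
proof -
  have "Lfun (dchar q (q - 1 - j)) s = (\<Sum>n. cnj (dchar q j n * of_real (real n powr -s)))"
    unfolding Lfun_def using dchar_diff[OF assms(1,2)] by simp
  also have "\<dots> = cnj (Lfun (dchar q j) s)"
    unfolding Lfun_def
    using mult_bounded.summable_restrict[OF mult_bounded_dchar[OF q] assms(3), of "\<lambda>_. True"]
    by (intro bounded_linear.suminf[OF bounded_linear_cnj, symmetric]) simp
  finally show ?thesis by simp
qed

lemma Lfun_dchar_nonzero: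
  assumes q: "prime q" and j: "0 < j" "j < q - 1"
  shows "Lfun (dchar q j) 1 \<noteq> 0"
proof (cases "2 * j = q - 1")
  case True
  thus ?thesis
    using periodic_zero_sum.Lfun_real_nonzero[OF periodic_zero_sum_dchar[OF q j]] dchar_half[OF q True] q by blast
next
  case False
  define j' where "j' = q - 1 - j"
  have j': "0 < j'" "j' < q - 1" "j' \<noteq> j" using False j by (auto simp: j'_def)
  show ?thesis
  proof
    assume zero: "Lfun (dchar q j) 1 = 0"
    obtain C where C: "C > 0" "\<And>s. s > 1 \<Longrightarrow> norm (Lfun (dchar q j) s - Lfun (dchar q j) 1) \<le> C * (s - 1)"
      using periodic_zero_sum.Lfun_lipschitz[OF periodic_zero_sum_dchar[OF q j]] by blast
    define A where "A = {..<q - 1} - {0, j, j'}"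
    \<comment> \<open>Two factors are at most C (s-1) and the principal one at most 1 + 1/(s-1) =
      s/(s-1), which leaves one power of s - 1. Every other factor is at most q.\<close>
    have bound: "exp (- 2 * real (q - 1)) \<le> s * C\<^sup>2 * real q ^ card A * (s - 1)" if s: "s > 1" for s
    proof -
      have Lj: "norm (Lfun (dchar q j) s) \<le> C * (s - 1)" using C(2)[OF s] zero by simp
      have Lj': "norm (Lfun (dchar q j') s) \<le> C * (s - 1)"
        using Lj norm_Lfun_dchar_diff[OF q _ s, of j] j by (simp add: j'_def)
      have L0: "norm (Lfun (dchar q 0) s) \<le> 1 + 1 / (s - 1)"
        by (rule mult_bounded.norm_Lfun_le[OF mult_bounded_dchar[OF q] s])
      have LA: "(\<Prod>i\<in>A. norm (Lfun (dchar q i) s)) \<le> (\<Prod>i\<in>A. real q)"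
        using s periodic_zero_sum.Lfun_nonprincipal(2)[OF periodic_zero_sum_dchar[OF q]]
        by (intro prod_mono) (auto simp: A_def)
      have eq: "{..<q - 1} = insert 0 (insert j (insert j' A))" and A: "finite A" "0 \<notin> A" "j \<notin> A" "j' \<notin> A"
        using j j' by (auto simp: A_def)
      have "(\<Prod>i<q - 1. norm (Lfun (dchar q i) s)) =
          norm (Lfun (dchar q 0) s) * (norm (Lfun (dchar q j) s) * (norm (Lfun (dchar q j') s) *
            (\<Prod>i\<in>A. norm (Lfun (dchar q i) s))))"
        unfolding eq using A j j' by simp
      also have "\<dots> \<le> (1 + 1 / (s - 1)) * (C * (s - 1) * (C * (s - 1) * (\<Prod>i\<in>A. real q)))"
        using s C(1) by (intro mult_mono L0 Lj Lj' LA) (auto intro!: mult_nonneg_nonneg prod_nonneg)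
      also have "\<dots> = s * C\<^sup>2 * real q ^ card A * (s - 1)"
        using s by (simp add: field_simps power2_eq_square)
      finally show ?thesis using prod_Lfun_dchar_ge[OF q s] by linarith
    qed
    have "((\<lambda>s. s * C\<^sup>2 * real q ^ card A * (s - 1)) \<longlongrightarrow> 0) (at_right 1)"
      by (auto intro!: tendsto_eq_intros)
    hence "exp (- 2 * real (q - 1)) \<le> 0"
      by (rule tendsto_lowerbound) (use bound in \<open>auto simp: eventually_at_filter\<close>)
    thus False by (simp add: not_le[symmetric])
  qed
qed

lemma prime_cong_1_not_cong_1:
  fixes p q :: nat
  assumes p: "prime p" "p > 2" and q: "prime q" and "p \<noteq> q"
  shows "\<exists>r. prime r \<and> [r = 1] (mod q) \<and> \<not> [r = 1] (mod p)"
proof (rule ccontr)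
  assume no: "\<not> ?thesis"
  \<comment> \<open>\<open>p > 2\<close> makes \<open>dchar p 1\<close> nonprincipal, so every twist
    \<open>F j\<close> is nonprincipal modulo pq and the twisted product has no pole at 1.\<close>
  define F where "F j = (\<lambda>n. dchar q j n * dchar p 1 n)" for j
  have F: "periodic_zero_sum (F j) (p * q)" for j
    unfolding F_def by (rule periodic_zero_sum_dchar_mult) (use assms in auto)
  hence F': "mult_bounded (F j)" for j
    by (simp add: periodic_zero_sum_def)
  note D = mult_bounded_dchar[OF q]
  \<comment> \<open>Each of the two comparisons with prime sums costs exp(2 (q-1)), and each of the
    q - 1 twisted factors is at most pq.\<close>
  define K where "K = exp (4 * real (q - 1)) * real (p * q) ^ (q - 1)"
  have upper: "(\<Prod>j<q - 1. norm (Lfun (dchar q j) s)) \<le> K" if s: "s > 1" for s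
  proof -
    \<comment> \<open>Both sums vanish unless n is 1 modulo q. For such primes the assumption gives
      n = 1 modulo p, so the twist is trivial.\<close>
    have sum_eq: "(\<Sum>j<q - 1. dchar q j n) = (\<Sum>j<q - 1. F j n)" if "prime n" for n
    proof -
      have "(\<Sum>j<q - 1. F j n) = (\<Sum>j<q - 1. dchar q j n) * dchar p 1 n"
        by (simp add: F_def sum_distrib_right)
      moreover have "dchar p 1 n = 1" if "[n = 1] (mod q)"
        using no that \<open>prime n\<close> dchar_cong_1[OF p(1)] by blast
      ultimately show ?thesis
        using sum_dchar[OF q, of n] by (cases "[n = 1] (mod q)") simp_all
    qed
    have "(\<Sum>j<q - 1. prime_sum (dchar q j) s) = (\<Sum>j<q - 1. prime_sum (F j) s)"
      by (subst (1 2) sum_prime_sum) (use D F' s sum_eq in \<open>auto cong: if_cong\<close>)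
    hence "(\<Prod>j<q - 1. norm (Lfun (dchar q j) s)) \<le>
             exp (Re (\<Sum>j<q - 1. prime_sum (F j) s) + 2 * real (q - 1))"
      using prod_Lfun_bounds(2)[of "{..<q - 1}" "dchar q", OF D s] by simp
    also have "\<dots> = exp (4 * real (q - 1)) * exp (Re (\<Sum>j<q - 1. prime_sum (F j) s) - 2 * real (q - 1))"
      by (simp flip: exp_add)
    also have "\<dots> \<le> exp (4 * real (q - 1)) * (\<Prod>j<q - 1. norm (Lfun (F j) s))"
      using prod_Lfun_bounds(1)[of "{..<q - 1}" F, OF F' s] by (intro mult_left_mono) auto
    also have "\<dots> \<le> exp (4 * real (q - 1)) * (\<Prod>j<q - 1. real (p * q))"
      using s periodic_zero_sum.Lfun_nonprincipal(2)[OF F] by (intro mult_left_mono prod_mono) auto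
    finally show ?thesis by (simp add: K_def)
  qed
  \<comment> \<open>Dividing by the principal factor, which is at least 1/(2(s-1)), forces the
    remaining product to tend to 0, although its limit is a product of nonzero values.\<close>
  have lower: "(\<Prod>j\<in>{1..<q - 1}. norm (Lfun (dchar q j) s)) \<le> 2 * K * (s - 1)" if s: "s > 1" for s
  proof -
    have "norm (Lfun (dchar q 0) s) \<ge> 1 / (2 * (s - 1))"
      by (rule norm_Lfun_principal_ge[OF s q]) (simp add: dchar_def)
    hence "1 / (2 * (s - 1)) * (\<Prod>j\<in>{1..<q - 1}. norm (Lfun (dchar q j) s)) \<le>
        norm (Lfun (dchar q 0) s) * (\<Prod>j\<in>{1..<q - 1}. norm (Lfun (dchar q j) s))"
      by (intro mult_right_mono prod_nonneg) auto
    also have "\<dots> = (\<Prod>j<q - 1. norm (Lfun (dchar q j) s))"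
    proof -
      have "{..<q - 1} = insert 0 {1..<q - 1}" using prime_gt_1_nat[OF q] by auto
      thus ?thesis by simp
    qed
    also have "\<dots> \<le> K" by (rule upper[OF s])
    finally show ?thesis using s by (simp add: field_simps)
  qed
  have lim: "((\<lambda>s. \<Prod>j\<in>{1..<q - 1}. norm (Lfun (dchar q j) s)) \<longlongrightarrow>
          (\<Prod>j\<in>{1..<q - 1}. norm (Lfun (dchar q j) 1))) (at_right 1)"
    by (intro tendsto_prod tendsto_norm periodic_zero_sum.Lfun_tendsto[OF periodic_zero_sum_dchar[OF q]]) auto
  have lim': "((\<lambda>s. 2 * K * (s - 1)) \<longlongrightarrow> 0) (at_right 1)"
    by (auto intro!: tendsto_eq_intros)
  have "(\<Prod>j\<in>{1..<q - 1}. norm (Lfun (dchar q j) 1)) \<le> 0"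
    by (rule tendsto_le[OF _ lim' lim]) (use lower in \<open>auto simp: eventually_at_filter\<close>)
  moreover have "(\<Prod>j\<in>{1..<q - 1}. norm (Lfun (dchar q j) 1)) > 0"
    using Lfun_dchar_nonzero[OF q] by (intro prod_pos) auto
  ultimately show False by linarith
qed

section \<open>The bound on m\<close>

lemma linnik_imp_small_ffun_dfun:
  fixes p q :: nat and c L :: real
  assumes pq: "prime p" "prime q" "odd p" "p < q" "p dvd q - 1" "\<not> p\<^sup>2 dvd q - 1"
    and linnik: "\<And>a q :: nat. 1 \<le> a \<Longrightarrow> a < q \<Longrightarrow> coprime a q \<Longrightarrow>
        real (LEAST p. prime p \<and> (\<exists>j. p = a + j * q)) \<le> c * real q powr L"
  shows "\<exists>m>0. real m \<le> c * real p * real (p * q) powr (L + 1) \<and> ffun m = q \<and> dfun m = p * q"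
proof -
  have gt: "p > 2" "q > 2"
    using pq prime_ge_2_nat[of p] by (auto simp: order_le_less)
  obtain r0 where r0: "prime r0" "[r0 = 1] (mod q)" "\<not> [r0 = 1] (mod p)"
    using prime_cong_1_not_cong_1[of p q] pq gt by blast
  \<comment> \<open>This makes r0 coprime to pq, and later gives q < r as the construction
    requires.\<close>
  have gt_q: "r > q" if "prime r" "[r = 1] (mod q)" for r
  proof (rule ccontr)
    assume "\<not> r > q"
    hence "r = q \<or> r < q" by auto
    moreover have "r mod q = 1" using that(2) gt unfolding cong_def by simp
    ultimately show False using prime_gt_1_nat[OF that(1)] by auto
  qed
  \<comment> \<open>r0 only certifies that its class modulo pq contains a prime. The least prime r
    of that class inherits both congruence conditions and obeys the Linnik bound.\<close>
  define a where "a = r0 mod (p * q)"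
  define Q where "Q r \<longleftrightarrow> prime r \<and> (\<exists>j. r = a + j * (p * q))" for r
  define r where "r = (LEAST r. Q r)"
  have "coprime r0 (p * q)"
    using primes_coprime[OF r0(1) pq(1)] primes_coprime[OF r0(1) pq(2)] gt_q[OF r0(1,2)] \<open>p < q\<close> by simp
  hence "coprime a (p * q)"
    unfolding a_def using gt by (subst coprime_mod_left_iff) auto
  moreover have "p * q > 1" using gt by (intro less_1_mult) auto
  moreover have "a < p * q" unfolding a_def using gt by (intro mod_less_divisor) simp
  moreover have "a \<noteq> 0" using calculation by (metis coprime_0_left_iff nat_dvd_1_iff_1 less_irrefl)
  ultimately have a: "1 \<le> a" "a < p * q" "coprime a (p * q)" by simp_all
  have "r0 = a + (r0 div (p * q)) * (p * q)"
    unfolding a_def by (rule mod_div_mult_eq [symmetric])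
  hence "Q r0" using r0(1) unfolding Q_def by blast
  hence "Q r" unfolding r_def by (rule LeastI)
  then obtain j where r: "prime r" "r = a + j * (p * q)" by (auto simp: Q_def)
  have "[r = r0] (mod (p * q))" by (simp add: r(2) a_def cong_def)
  hence cong: "[r = r0] (mod p)" "[r = r0] (mod q)"
    by (metis cong_modulus_mult_nat, metis cong_modulus_mult_nat mult.commute)
  have r_q: "[r = 1] (mod q)" and r_p: "\<not> [r = 1] (mod p)"
    using cong r0 by (meson cong_trans, meson cong_sym cong_trans)
  have "q < r" by (rule gt_q[OF r(1) r_q])
  have "q dvd r - 1" "\<not> p dvd r - 1"
    using r_q r_p cong_altdef_nat[OF prime_ge_1_nat[OF r(1)]] by blast+
  have "real r \<le> c * real (p * q) powr L"
    using linnik[OF a] by (simp add: r_def Q_def)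
  \<comment> \<open>One factor pq of p^2 q raises the exponent from L to L + 1, and the other p
    remains in front.\<close>
  hence "real (p\<^sup>2 * q * r) \<le> real (p\<^sup>2 * q) * (c * real (p * q) powr L)"
    by (simp add: mult_left_mono)
  also have "\<dots> = c * real p * (real (p * q) powr L * real (p * q))"
    by (simp add: power2_eq_square mult_ac)
  also have "real (p * q) powr L * real (p * q) = real (p * q) powr (L + 1)"
    using gt by (simp add: powr_add)
  finally have "real (p\<^sup>2 * q * r) \<le> c * real p * real (p * q) powr (L + 1)" .
  moreover have "p\<^sup>2 * q * r > 0" using gt \<open>q < r\<close> by simp
  ultimately show ?thesis
    using ffun_dfun_construction[OF pq(1,2) r(1) pq(3,4) \<open>q < r\<close> pq(5,6) \<open>q dvd r - 1\<close> \<open>\<not> p dvd r - 1\<close>]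
    by blast
qed

theorem theorem1p4:
  shows "(\<forall>n::nat. odd n \<and> n > 1 \<longrightarrow>
            \<not> (\<exists>m>0. ffun m = n \<and> dfun m = 2 * n) \<and>
            \<not> (\<exists>m>0. ffun m = n \<and> dfun m = 4 * n))
       \<and> (\<forall>L::real. linnik_constant L \<longrightarrow>
            (\<exists>C::real. C > 0 \<and>
              (\<forall>p q :: nat. prime p \<and> prime q \<and> odd p \<and> odd q \<and> p < q \<and>
                  p dvd q - 1 \<and> \<not> p^2 dvd q - 1 \<longrightarrow>
                  (\<exists>m>0. real m \<le> C * real p * (real (p * q)) powr (L + 1) \<and>
                         ffun m = q \<and> dfun m = p * q))))"
proof (intro conjI allI impI)
  fix L :: real assume "linnik_constant L"
  then obtain c where "c > 0" and c: "\<And>a q :: nat. 1 \<le> a \<Longrightarrow> a < q \<Longrightarrow> coprime a q \<Longrightarrow>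
      real (LEAST p. prime p \<and> (\<exists>j. p = a + j * q)) \<le> c * real q powr L"
    unfolding linnik_constant_def by blast
  have "\<exists>m>0. real m \<le> c * real p * (real (p * q)) powr (L + 1) \<and> ffun m = q \<and> dfun m = p * q"
    if "prime p \<and> prime q \<and> odd p \<and> odd q \<and> p < q \<and> p dvd q - 1 \<and> \<not> p^2 dvd q - 1" for p q :: nat
    using that by (intro linnik_imp_small_ffun_dfun c) auto
  thus "\<exists>C::real. C > 0 \<and>
              (\<forall>p q :: nat. prime p \<and> prime q \<and> odd p \<and> odd q \<and> p < q \<and>
                  p dvd q - 1 \<and> \<not> p^2 dvd q - 1 \<longrightarrow>
                  (\<exists>m>0. real m \<le> C * real p * (real (p * q)) powr (L + 1) \<and>
                         ffun m = q \<and> dfun m = p * q))"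
    using \<open>c > 0\<close> by (intro exI[of _ c]) simp
next
  fix n :: nat assume n: "odd n \<and> n > 1"
  show "\<not> (\<exists>m>0. ffun m = n \<and> dfun m = 2 * n)" "\<not> (\<exists>m>0. ffun m = n \<and> dfun m = 4 * n)"
    using ffun_dfun_odd_impossible[of n] n by metis+
qed

end
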